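(* Let $L:(0,\infty)\to(0,\infty)$ be a slowly varying function which is eventually monotone, i.e. there is $N_0>0$ such that $L$ is monotone on $[N_0,\infty)$, and let $\beta>0$. Let $1<p\leq\frac{n}{(n-2\beta)_+}$, $\sigma=\frac{n}{\beta}\left(1-\frac{1}{p}\right)$, $A>0$, and let $\gamma>0$ satisfy $$\gamma>\sigma\ \text{ if } L \text{ is eventually increasing},\qquad \gamma=\sigma\ \text{ if } L \text{ is eventually decreasing}.$$ Let $J=J(|x|)\geq0$ be a radial function in $L^1(\mathbb{R}^n)$ with $\chi_0=\|J\|_{L^1}=1$ such that $$\widehat{J}(\xi)=1-A|\xi|^{\sigma}L\left(|\xi|^{-\gamma}\right)+o\left(|\xi|^{\sigma}L\left(|\xi|^{-\gamma}\right)\right)\quad\text{as } |\xi|\to0,$$ and let $u_0\in L^1(\mathbb{R}^n)$ with $\widehat{u}_0\in L^1(\mathbb{R}^n)$. Then there is a positive integer $N=N(n,J)$ such that $\mathcal{J}^ku_0\in L^p(\mathbb{R}^n)$ for all $k$ and $$\|\mathcal{J}^ku_0\|_{L^p}\leq C\left(\|u_0\|_{L^1}+\|\widehat{u}_0\|_{L^1}\right)(kL(k))^{-\beta}\quad\text{for all } k\geq N,$$ where $C>0$ is a constant. Moreover, in this case, the solution $u(t)$ of $$\partial_tu(x,t)=\int_{\mathbb{R}^n}J(x-y)u(y,t)\,dy-\chi_0u(x,t),\quad (x,t)\in\mathbb{R}^n\times(0,\infty),$$ with initial value $u_0$ satisfies $$\|u(t)\|_{L^p}\lesssim(tL(t))^{-\beta}\quad\text{as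 } t\to\infty.$$
   Context: A measurable function $L:(0,\infty)\to(0,\infty)$ is slowly varying if $\lim_{s\to\infty}L(\lambda s)/L(s)=1$ for all $\lambda>0$. $a_+=\max\{a,0\}$, and $\frac{n}{(n-2\beta)_+}=\infty$ when $n\le2\beta$ (so $p=\infty$ is allowed then). $\mathcal{J}u=J\ast u$ and $\mathcal{J}^k$ is its $k$-fold composition. By definition, the solution of $\partial_tu=\mathcal{J}u-\chi_0u$ with initial value $u_0$ is $u(t)=e^{-\chi_0t}\sum_{k=0}^\infty\frac{t^k}{k!}\mathcal{J}^ku_0$. The Fourier transform is $\widehat{f}(\xi)=\int_{\mathbb{R}^n}f(x)e^{-ix\cdot\xi}\,dx$. The notation $f(t)\lesssim g(t)$ as $t\to\infty$ means that there are constants $C,t_0>0$ with $f(t)\le Cg(t)$ for all $t\ge t_0$. *)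

theory Defs
  imports
    "HOL-Analysis.Analysis"
    "HOL-Library.Landau_Symbols"
    "HOL-Probability.Essential_Supremum"
begin

text \<open>
  Elements of \<open>L\<^sup>p\<close> are represented by Lebesgue measurable functions.  \<open>Lp_norm\<close> is real-valued,
  so it is meaningful only for members of \<open>Lp_space\<close>.
\<close>

definition Lp_space ::
  "ennreal \<Rightarrow> ('a::euclidean_space \<Rightarrow> 'b::{banach, second_countable_topology}) set" where
  "Lp_space p = {f \<in> borel_measurable lebesgue.
     if p = \<infinity> then esssup lebesgue (\<lambda>x. ennreal (norm (f x))) < \<infinity>
     else integrable lebesgue (\<lambda>x. norm (f x) powr enn2real p)}"

definition Lp_norm ::
  "ennreal \<Rightarrow> ('a::euclidean_space \<Rightarrow> 'b::{banach, second_countable_topology}) \<Rightarrow> real" where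
  "Lp_norm p f =
     (if p = \<infinity> then enn2real (esssup lebesgue (\<lambda>x. ennreal (norm (f x))))
      else (LINT x|lebesgue. norm (f x) powr enn2real p) powr (1 / enn2real p))"

lemma Lp_space_1_iff: "f \<in> Lp_space 1 \<longleftrightarrow> integrable lebesgue f"
  unfolding Lp_space_def by (auto simp: integrable_norm_iff)

lemma Lp_norm_1: "Lp_norm 1 f = (LINT x|lebesgue. norm (f x))"
  unfolding Lp_norm_def by simp

definition slowly_varying :: "(real \<Rightarrow> real) \<Rightarrow> bool" where
  "slowly_varying L \<longleftrightarrow>
     L \<in> borel_measurable (restrict_space lebesgue {0<..}) \<and>
     (\<forall>s>0. L s > 0) \<and>
     (\<forall>c>0. ((\<lambda>s. L (c * s) / L s) \<longlongrightarrow> 1) at_top)"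

definition radial :: "('a::real_normed_vector \<Rightarrow> 'b) \<Rightarrow> bool" where
  "radial f \<longleftrightarrow> (\<exists>g. \<forall>x. f x = g (norm x))"

definition fourier :: "('a::euclidean_space \<Rightarrow> complex) \<Rightarrow> 'a \<Rightarrow> complex" where
  "fourier f \<xi> = (LINT x|lebesgue. f x * exp (- (\<i> * complex_of_real (x \<bullet> \<xi>))))"

definition conv_op ::
  "('a::euclidean_space \<Rightarrow> real) \<Rightarrow> ('a \<Rightarrow> complex) \<Rightarrow> 'a \<Rightarrow> complex" where
  "conv_op J u = (\<lambda>x. LINT y|lebesgue. complex_of_real (J (x - y)) * u y)"

text \<open>
  The series is taken pointwise.  For \<open>J, u0 \<in> L\<^sup>1\<close> it converges absolutely almost everywhere, and
  its sum represents the \<open>L\<^sup>1\<close>-limit of the partial sums.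
\<close>

definition nonlocal_solution ::
  "('a::euclidean_space \<Rightarrow> real) \<Rightarrow> ('a \<Rightarrow> complex) \<Rightarrow> real \<Rightarrow> 'a \<Rightarrow> complex" where
  "nonlocal_solution J u0 t = (\<lambda>x. complex_of_real (exp (- Lp_norm 1 J * t)) *
     (\<Sum>k. complex_of_real (t ^ k / fact k) * (conv_op J ^^ k) u0 x))"

end

theory Submission
  imports Defs "HOL-Probability.Characteristic_Functions" "HOL-Real_Asymp.Real_Asymp"
begin

text \<open>
  Let \<open>m\<close> and \<open>v\<close> be the Fourier transforms of \<open>J\<close> and \<open>u0\<close>, let \<open>\<phi> = 1 - |m|\<close>, let \<open>n\<close> be the
  dimension, and let \<open>I t\<close> be the integral of \<open>exp (- t \<phi>) |v|\<close> (\<open>symbol_integral\<close>).  Everything is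
  controlled by this one function of a real parameter.

  Convolution with \<open>J\<close> multiplies the transform by \<open>m\<close>, and \<open>|m|\<^sup>k \<le> exp (- k \<phi>)\<close>, so Fourier
  inversion bounds the \<open>k\<close>-th iterate by \<open>I k / (2 \<pi>)\<^sup>n\<close> almost everywhere.  The solution at time \<open>t\<close>
  is the average of the iterates over a Poisson distribution with mean \<open>t\<close>, and the same average of
  \<open>|m|\<^sup>k\<close> is exactly \<open>exp (- t \<phi>)\<close>; hence the solution is bounded by \<open>I t / (2 \<pi>)\<^sup>n\<close>.  Neither
  convolution with \<open>J\<close> nor averaging increases the \<open>L\<^sup>1\<close> norm.  Interpolation between \<open>L\<^sup>1\<close> and
  \<open>L\<^sup>\<infinity>\<close> raises the supremum bound to the power \<open>1 - 1/p\<close>, and \<open>\<sigma>\<close> is chosen so that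
  \<open>(n/\<sigma>) (1 - 1/p) = \<beta>\<close>.  It remains to show \<open>I t = O ((t L(t)) powr (- n/\<sigma>))\<close> as \<open>t\<close> tends to infinity.

  Far from the origin \<open>\<phi>\<close> is bounded below by a positive constant (\<open>fourier_density_gap\<close>: strict
  inequality \<open>|m| < 1\<close> off the origin, continuity, and the Riemann--Lebesgue lemma), and this part
  decays exponentially.  Near the origin the expansion of \<open>m\<close> gives
  \<open>\<phi>(\<xi>) \<ge> (A/2) |\<xi>|\<^sup>\<sigma> L(|\<xi>| powr (- \<gamma>))\<close>.  Whenever \<open>L(|\<xi>| powr (- \<gamma>)) \<ge> L(t)\<close>, the factor
  \<open>exp (- t \<phi>)\<close> is at most \<open>exp (- (A/2) t L(t) |\<xi>|\<^sup>\<sigma>)\<close>, whose integral scales like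
  \<open>(t L(t)) powr (- n/\<sigma>)\<close>.  Monotonicity decides where this comparison holds.  For increasing \<open>L\<close> it
  can fail only if \<open>|\<xi>| > t powr (- 1/\<gamma>)\<close>, where \<open>t \<phi>(\<xi>)\<close> exceeds a multiple of
  \<open>t powr (1 - \<sigma>/\<gamma>)\<close>, a positive power because \<open>\<gamma> > \<sigma>\<close>.  For decreasing \<open>L\<close> and \<open>\<gamma> = \<sigma>\<close> it can fail
  only on the ball of radius \<open>t powr (- 1/\<sigma>)\<close>, whose volume is of the right order since \<open>L\<close> is then
  bounded above at infinity.  Both remainders are absorbed (\<open>integral_exp_neg_regular_variation\<close>).

  The analytic input, an inversion bound for functions with integrable transform
  (\<open>AE_norm_le_fourier_integral\<close>) and the Riemann--Lebesgue lemma, rests on the continuity of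
  translations in \<open>L\<^sup>1\<close> (\<open>L1_translation_continuous\<close>).  Lebesgue measurable functions are replaced by
  Borel representatives, so that Fubini's theorem applies on products of \<open>lborel\<close>.

  The constant \<open>C\<close> may depend on \<open>L\<close> and the exponents, so finitely many small \<open>k\<close> cost nothing and
  \<open>N = 1\<close> is admissible.
\<close>

section \<open>Translations in the space of integrable functions\<close>

lemma integral_affine:
  fixes f :: "'a::euclidean_space \<Rightarrow> 'b::{banach,second_countable_topology}"
  assumes [measurable]: "f \<in> borel_measurable borel" and c: "c \<noteq> 0"
  shows "(LINT x|lborel. f x) = \<bar>c\<bar> ^ DIM('a) *\<^sub>R (LINT x|lborel. f (t + c *\<^sub>R x))"
  by (subst lborel_affine[OF c, of t]) (simp add: integral_density integral_distr)

lemma integrable_affine: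
  fixes f :: "'a::euclidean_space \<Rightarrow> 'b::{banach,second_countable_topology}"
  assumes f: "integrable lborel f" and c: "c \<noteq> 0"
  shows "integrable lborel (\<lambda>x. f (t + c *\<^sub>R x))"
proof -
  note [measurable] = borel_measurable_integrable[OF f]
  have "integrable lborel (\<lambda>x. \<bar>c\<bar> ^ DIM('a) *\<^sub>R f (t + c *\<^sub>R x))"
    using f by (subst (asm) lborel_affine[OF c, of t]) (simp add: integrable_density integrable_distr_eq)
  then have "integrable lborel (\<lambda>x. inverse (\<bar>c\<bar> ^ DIM('a)) *\<^sub>R \<bar>c\<bar> ^ DIM('a) *\<^sub>R f (t + c *\<^sub>R x))"
    by (intro Bochner_Integration.integrable_scaleR_right[of "inverse (\<bar>c\<bar> ^ DIM('a))"])
  moreover have "inverse (\<bar>c\<bar> ^ DIM('a)) *\<^sub>R \<bar>c\<bar> ^ DIM('a) *\<^sub>R f (t + c *\<^sub>R x) = f (t + c *\<^sub>R x)" for x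
    using c by simp
  ultimately show ?thesis by (simp only:)
qed

lemma integral_translate:
  fixes f :: "'a::euclidean_space \<Rightarrow> 'b::{banach,second_countable_topology}"
  assumes "f \<in> borel_measurable borel"
  shows "(LINT x|lborel. f (x + h)) = (LINT x|lborel. f x)"
  using integral_affine[OF assms, of 1 h] by (simp add: add.commute)

lemma integrable_translate:
  fixes f :: "'a::euclidean_space \<Rightarrow> 'b::{banach,second_countable_topology}"
  assumes "integrable lborel f"
  shows "integrable lborel (\<lambda>x. f (x + h))"
  using integrable_affine[OF assms, of 1 h] by (simp add: add.commute)

text \<open>
  The property passes to \<open>L\<^sup>1\<close>-limits, because translations are isometries of \<open>L\<^sup>1\<close>.
\<close>

lemma L1_translation_continuous_approx:
  fixes f :: "'a::euclidean_space \<Rightarrow> 'b::{banach,second_countable_topology}"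
  assumes f: "integrable lborel f"
    and approx: "\<And>e::real. e > 0 \<Longrightarrow> \<exists>g. integrable lborel g \<and> (LINT x|lborel. norm (f x - g x)) \<le> e \<and>
          (\<lambda>n. LINT x|lborel. norm (g (x + h n) - g x)) \<longlonglongrightarrow> 0"
  shows "(\<lambda>n. LINT x|lborel. norm (f (x + h n) - f x)) \<longlonglongrightarrow> 0"
proof (rule LIMSEQ_I)
  fix r :: real assume "r > 0"
  then obtain g where g: "integrable lborel g" "(LINT x|lborel. norm (f x - g x)) \<le> r/4"
      "(\<lambda>n. LINT x|lborel. norm (g (x + h n) - g x)) \<longlonglongrightarrow> 0"
    using approx[of "r/4"] by auto
  from LIMSEQ_D[OF g(3), of "r/2"] \<open>r > 0\<close> obtain N where
    N: "\<And>n. n \<ge> N \<Longrightarrow> norm ((LINT x|lborel. norm (g (x + h n) - g x)) - 0) < r/2" by auto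
  note [measurable] = borel_measurable_integrable[OF f] borel_measurable_integrable[OF g(1)]
  have "norm ((LINT x|lborel. norm (f (x + h n) - f x)) - 0) < r" if n: "n \<ge> N" for n
  proof -
    have fg: "integrable lborel (\<lambda>x. norm (f x - g x))" using f g by auto
    have fgh: "integrable lborel (\<lambda>x. norm (f (x + h n) - g (x + h n)))"
      using integrable_translate[OF f] integrable_translate[OF g(1)] by auto
    have gg: "integrable lborel (\<lambda>x. norm (g (x + h n) - g x))"
      using g(1) integrable_translate[OF g(1)] by auto
    have "(LINT x|lborel. norm (f (x + h n) - f x))
      \<le> (LINT x|lborel. norm (f (x + h n) - g (x + h n)) + norm (f x - g x) + norm (g (x + h n) - g x))"
    proof (rule integral_mono)
      show "norm (f (x + h n) - f x) \<le> norm (f (x + h n) - g (x + h n)) + norm (f x - g x) + norm (g (x + h n) - g x)" for x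
        using norm_triangle_ineq4[of "(f (x + h n) - g (x + h n)) + (g (x + h n) - g x)" "f x - g x"]
          norm_triangle_ineq[of "f (x + h n) - g (x + h n)" "g (x + h n) - g x"] by simp
    qed (use f integrable_translate[OF f] fg fgh gg in auto)
    also have "\<dots> = (LINT x|lborel. norm (f x - g x)) + (LINT x|lborel. norm (f x - g x)) + (LINT x|lborel. norm (g (x + h n) - g x))"
      using fg fgh gg integral_translate[of "\<lambda>x. norm (f x - g x)" "h n"] by simp
    also have "\<dots> < r" using g(2) N[OF n] \<open>r > 0\<close> by simp
    finally show ?thesis by simp
  qed
  then show "\<exists>no. \<forall>n\<ge>no. norm ((LINT x|lborel. norm (f (x + h n) - f x)) - 0) < r" by blast
qed

text \<open>
  For \<open>x\<close> in an open \<open>U\<close> the points \<open>x + h\<^sub>n\<close> eventually lie in \<open>U\<close>, so the measure of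
  \<open>U \<inter> (U - h\<^sub>n)\<close> tends to that of \<open>U\<close> by dominated convergence.  Since \<open>U\<close> and \<open>U - h\<^sub>n\<close> have equal
  measure, their symmetric difference is then small too.
\<close>

lemma L1_translation_continuous_open:
  fixes U :: "'a::euclidean_space set"
  assumes U: "open U" "emeasure lborel U < \<infinity>" and h: "h \<longlonglongrightarrow> 0"
  shows "(\<lambda>n. LINT x|lborel. norm (indicator U (x + h n) - indicator U x :: real)) \<longlonglongrightarrow> 0"
proof -
  have [measurable]: "U \<in> sets borel" using U by auto
  have i: "integrable lborel (indicator U :: 'a \<Rightarrow> real)" using U by auto
  have eq: "norm (indicator U y - indicator U x :: real)
      = indicator U y + indicator U x - 2 * (indicator U x * indicator U y)" for x y
    by (auto simp: indicator_def)
  have ih: "integrable lborel (\<lambda>x. indicator U x * indicator U (x + h n) :: real)" for n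
    by (rule Bochner_Integration.integrable_bound[OF i]) (auto simp: indicator_def)
  have "(\<lambda>n. LINT x|lborel. indicator U x * indicator U (x + h n) :: real) \<longlonglongrightarrow> (LINT x|lborel. indicator U x)"
  proof (rule integral_dominated_convergence[where w = "indicator U"])
    show "AE x in lborel. (\<lambda>n. indicator U x * indicator U (x + h n)) \<longlonglongrightarrow> (indicator U x :: real)"
    proof (intro AE_I2)
      fix x :: 'a
      show "(\<lambda>n. indicator U x * indicator U (x + h n)) \<longlonglongrightarrow> (indicator U x :: real)"
      proof (cases "x \<in> U")
        case True
        have "(\<lambda>n. x + h n) \<longlonglongrightarrow> x + 0" by (intro tendsto_intros h)
        then have "eventually (\<lambda>n. x + h n \<in> U) sequentially"
          using U(1) True topological_tendstoD by fastforce
        then have "eventually (\<lambda>n. indicator U x * indicator U (x + h n) = (1::real)) sequentially"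
          by eventually_elim (use True in auto)
        then show ?thesis using True by (simp add: tendsto_eventually)
      qed simp
    qed
  qed (use i in \<open>auto simp: indicator_def\<close>)
  then have "(\<lambda>n. 2 * (LINT x|lborel. indicator U x) - 2 * (LINT x|lborel. indicator U x * indicator U (x + h n) :: real))
      \<longlonglongrightarrow> 2 * (LINT x|lborel. indicator U x) - 2 * (LINT x|lborel. indicator U x)"
    by (intro tendsto_intros)
  moreover have "(LINT x|lborel. norm (indicator U (x + h n) - indicator U x :: real)) =
     2 * (LINT x|lborel. indicator U x) - 2 * (LINT x|lborel. indicator U x * indicator U (x + h n) :: real)" for n
    unfolding eq using i ih[of n] integrable_translate[OF i, of "h n"] integral_translate[of "indicator U :: 'a \<Rightarrow> real" "h n"] by simp
  ultimately show ?thesis by simp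
qed

text \<open>
  Outer regularity reduces indicators of Borel sets to indicators of open sets; sums and
  dominated limits give all integrable functions.
\<close>

theorem L1_translation_continuous:
  fixes f :: "'a::euclidean_space \<Rightarrow> 'b::{banach,second_countable_topology}"
  assumes f: "integrable lborel f" and h: "h \<longlonglongrightarrow> 0"
  shows "(\<lambda>n. LINT x|lborel. norm (f (x + h n) - f x)) \<longlonglongrightarrow> 0"
  using f
proof (induction rule: integrable_induct)
  case (base A c)
  have [measurable]: "A \<in> sets borel" using base by simp
  have iA: "integrable lborel (indicator A :: 'a \<Rightarrow> real)" using base by simp
  have "(\<lambda>n. LINT x|lborel. norm (indicator A (x + h n) - indicator A x :: real)) \<longlonglongrightarrow> 0"
  proof (rule L1_translation_continuous_approx[OF iA])
    fix e :: real assume "e > 0"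
    obtain U where U: "open U" "A \<subseteq> U" "emeasure lborel (U - A) < e"
      using outer_regular_lborel[of A e] \<open>e > 0\<close> by auto
    have [measurable]: "U \<in> sets borel" using U by simp
    have "emeasure lborel U = emeasure lborel (U - A) + emeasure lborel A"
      using U by (subst plus_emeasure) (auto intro!: arg_cong[where f="emeasure lborel"])
    also have "\<dots> < \<infinity>" using U(3) base by (auto simp: less_top[symmetric] dest: order.strict_trans2)
    finally have fU: "emeasure lborel U < \<infinity>" .
    have iU: "integrable lborel (indicator U :: 'a \<Rightarrow> real)" using fU by simp
    have "(LINT x|lborel. norm (indicator A x - indicator U x :: real)) = (LINT x|lborel. indicator (U - A) x)"
      by (intro Bochner_Integration.integral_cong) (use U in \<open>auto simp: indicator_def\<close>)
    also have "\<dots> = measure lborel (U - A)" by simp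
    also have "\<dots> \<le> e" using enn2real_leI[OF _ less_imp_le[OF U(3)]] \<open>e > 0\<close> unfolding measure_def
      by simp
    finally have "(LINT x|lborel. norm (indicator A x - indicator U x :: real)) \<le> e" .
    then show "\<exists>g. integrable lborel g \<and> (LINT x|lborel. norm (indicator A x - g x :: real)) \<le> e \<and>
          (\<lambda>n. LINT x|lborel. norm (g (x + h n) - g x)) \<longlonglongrightarrow> 0"
      by (intro exI[of _ "indicator U"] conjI iU L1_translation_continuous_open[OF U(1) fU h])
  qed
  then have "(\<lambda>n. (LINT x|lborel. norm (indicator A (x + h n) - indicator A x :: real)) * norm c) \<longlonglongrightarrow> 0 * norm c"
    by (intro tendsto_intros)
  then show ?case by (simp add: scaleR_left_diff_distrib[symmetric])
next
  case (add f g)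
  note [measurable] = borel_measurable_integrable[OF add(1)] borel_measurable_integrable[OF add(2)]
  have "(\<lambda>n. (LINT x|lborel. norm (f (x + h n) - f x)) + (LINT x|lborel. norm (g (x + h n) - g x))) \<longlonglongrightarrow> 0 + 0"
    by (intro tendsto_add add.IH)
  then have 0: "(\<lambda>n. (LINT x|lborel. norm (f (x + h n) - f x)) + (LINT x|lborel. norm (g (x + h n) - g x))) \<longlonglongrightarrow> 0"
    by simp
  show ?case
  proof (rule Lim_null_comparison[OF _ 0])
    show "eventually (\<lambda>n. norm (LINT x|lborel. norm (f (x + h n) + g (x + h n) - (f x + g x)))
       \<le> (LINT x|lborel. norm (f (x + h n) - f x)) + (LINT x|lborel. norm (g (x + h n) - g x))) sequentially"
    proof (intro always_eventually allI)
      fix n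
      have 1: "integrable lborel (\<lambda>x. f (x + h n) - f x)" "integrable lborel (\<lambda>x. g (x + h n) - g x)"
        by (auto intro!: Bochner_Integration.integrable_diff integrable_translate add.hyps)
      have "(LINT x|lborel. norm (f (x + h n) + g (x + h n) - (f x + g x)))
        \<le> (LINT x|lborel. norm (f (x + h n) - f x) + norm (g (x + h n) - g x))"
      proof (rule integral_mono)
        show "integrable lborel (\<lambda>x. norm (f (x + h n) + g (x + h n) - (f x + g x)))"
          using Bochner_Integration.integrable_add[OF 1] by (intro integrable_norm) (simp add: algebra_simps)
        show "norm (f (x + h n) + g (x + h n) - (f x + g x)) \<le> norm (f (x + h n) - f x) + norm (g (x + h n) - g x)" for x
          by (metis norm_diff_triangle_ineq)
      qed (use 1 in auto)
      also have "\<dots> = (LINT x|lborel. norm (f (x + h n) - f x)) + (LINT x|lborel. norm (g (x + h n) - g x))"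
        using 1 by simp
      finally show "norm (LINT x|lborel. norm (f (x + h n) + g (x + h n) - (f x + g x))) \<le> \<dots>" by simp
    qed
  qed
next
  case (lim f s)
  show ?case
  proof (rule L1_translation_continuous_approx[OF lim.hyps(4)])
    fix e :: real assume "e > 0"
    note [measurable] = borel_measurable_integrable[OF lim.hyps(4)] borel_measurable_integrable[OF lim.hyps(1)]
    have "(\<lambda>i. LINT x|lborel. norm (f x - s i x)) \<longlonglongrightarrow> (LINT x::'a|lborel. 0)"
    proof (rule integral_dominated_convergence[where w = "\<lambda>x. 3 * norm (f x)"])
      show "AE x in lborel. (\<lambda>i. norm (f x - s i x)) \<longlonglongrightarrow> 0"
        using lim.hyps(2) by (auto intro!: AE_I2 tendsto_norm_zero LIM_zero simp: norm_minus_commute[of "f _"])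
      show "AE x in lborel. norm (norm (f x - s i x)) \<le> 3 * norm (f x)" for i
        using lim.hyps(3)[of _ i] norm_triangle_ineq4[of "f _" "s i _"] by (auto intro!: AE_I2) (smt (verit))
    qed (use lim.hyps in auto)
    then have "eventually (\<lambda>i. (LINT x|lborel. norm (f x - s i x)) < e) sequentially"
      using \<open>e > 0\<close> order_tendstoD(2) by fastforce
    then obtain i where "(LINT x|lborel. norm (f x - s i x)) < e" by (auto simp: eventually_sequentially)
    then show "\<exists>g. integrable lborel g \<and> (LINT x|lborel. norm (f x - g x)) \<le> e \<and>
          (\<lambda>n. LINT x|lborel. norm (g (x + h n) - g x)) \<longlonglongrightarrow> 0"
      using lim.hyps(1)[of i] lim.IH[of i] by (intro exI[of _ "s i"]) auto
  qed
qed

section \<open>The Fourier transform of integrable functions\<close>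

lemma borel_measurable_exp_minus_i [measurable]:
  assumes [measurable]: "g \<in> borel_measurable M"
  shows "(\<lambda>x. exp (- (\<i> * complex_of_real (g x)))) \<in> borel_measurable M"
proof -
  have [measurable]: "(\<lambda>t. exp (- (\<i> * complex_of_real t))) \<in> borel_measurable borel"
    by (intro borel_measurable_continuous_onI continuous_intros)
  show ?thesis by measurable
qed

lemma fourier_lborel:
  fixes f :: "'a::euclidean_space \<Rightarrow> complex"
  assumes [measurable]: "f \<in> borel_measurable borel"
  shows "fourier f \<xi> = (LINT x|lborel. f x * exp (- (\<i> * complex_of_real (x \<bullet> \<xi>))))"
proof -
  have "(\<lambda>x. f x * exp (- (\<i> * complex_of_real (x \<bullet> \<xi>)))) \<in> borel_measurable borel" by measurable
  then show ?thesis unfolding fourier_def by (intro integral_completion) simp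
qed

lemma norm_exp_minus_i_real [simp]: "norm (exp (- (\<i> * complex_of_real t))) = 1"
  using norm_exp_i_times[of "-t"] by simp

lemma integrable_fourier_integrand:
  assumes f: "integrable lborel f"
  shows "integrable lborel (\<lambda>x. f x * exp (- (\<i> * complex_of_real (x \<bullet> \<xi>))))"
proof -
  note [measurable] = borel_measurable_integrable[OF f]
  show ?thesis by (rule Bochner_Integration.integrable_bound[OF f]) (auto simp: norm_mult)
qed

lemma norm_fourier_le:
  assumes f: "integrable lborel f"
  shows "norm (fourier f \<xi>) \<le> (LINT x|lborel. norm (f x))"
proof -
  have "norm (fourier f \<xi>) \<le> (LINT x|lborel. norm (f x * exp (- (\<i> * complex_of_real (x \<bullet> \<xi>)))))"
    using borel_measurable_integrable[OF f] by (subst fourier_lborel) (auto intro: integral_norm_bound)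
  then show ?thesis by (simp add: norm_mult)
qed

lemma isCont_fourier:
  assumes f: "integrable lborel f"
  shows "isCont (fourier f) \<xi>"
  unfolding continuous_at_sequentially comp_def
proof (intro allI impI)
  fix X assume X: "X \<longlonglongrightarrow> \<xi>"
  note [measurable] = borel_measurable_integrable[OF f]
  have "(\<lambda>n. LINT x|lborel. f x * exp (- (\<i> * complex_of_real (x \<bullet> X n))))
      \<longlonglongrightarrow> (LINT x|lborel. f x * exp (- (\<i> * complex_of_real (x \<bullet> \<xi>))))"
  proof (rule integral_dominated_convergence[where w = "\<lambda>x. norm (f x)"])
    show "AE x in lborel. (\<lambda>n. f x * exp (- (\<i> * complex_of_real (x \<bullet> X n))))
        \<longlonglongrightarrow> f x * exp (- (\<i> * complex_of_real (x \<bullet> \<xi>)))"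
      by (intro AE_I2 tendsto_intros X)
  qed (use f in \<open>auto simp: norm_mult\<close>)
  then show "(\<lambda>n. fourier f (X n)) \<longlonglongrightarrow> fourier f \<xi>"
    by (simp add: fourier_lborel)
qed

lemma borel_measurable_fourier:
  assumes f: "integrable lborel f"
  shows "fourier f \<in> borel_measurable borel"
  using isCont_fourier[OF f] by (intro borel_measurable_continuous_onI continuous_at_imp_continuous_on) auto

section \<open>Gaussian densities\<close>

definition gauss_density :: "'a::euclidean_space \<Rightarrow> real" where
  "gauss_density x = (\<Prod>b\<in>Basis. std_normal_density (x \<bullet> b))"

lemma gauss_density_eq:
  "gauss_density (x::'a::euclidean_space) = (1 / sqrt (2 * pi)) ^ DIM('a) * exp (- (norm x)\<^sup>2 / 2)"
proof -
  have "(norm x)\<^sup>2 = (\<Sum>b\<in>Basis. (x \<bullet> b)\<^sup>2)"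
    by (subst power2_norm_eq_inner, subst euclidean_inner) (simp add: power2_eq_square)
  then have "exp (- (norm x)\<^sup>2 / 2) = (\<Prod>b\<in>Basis. exp (- (x \<bullet> b)\<^sup>2 / 2))"
    by (simp add: exp_sum[symmetric] sum_negf sum_divide_distrib[symmetric])
  then show ?thesis
    by (simp add: gauss_density_def std_normal_density_def prod_dividef power_one_over)
qed

lemma gauss_density_nonneg: "gauss_density x \<ge> 0"
  by (simp add: gauss_density_def prod_nonneg)

lemma measurable_gauss_density [measurable]: "gauss_density \<in> borel_measurable borel"
  unfolding gauss_density_def by measurable

text \<open>
  Lebesgue measure is the image of a product measure indexed by the basis, so products of
  one-dimensional functions integrate factor by factor.
\<close>

lemma
  fixes g :: "'a::euclidean_space \<Rightarrow> real \<Rightarrow> 'b::{real_normed_field,banach,second_countable_topology}"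
  assumes g: "\<And>b. b \<in> Basis \<Longrightarrow> integrable lborel (g b)"
  shows integrable_prod_Basis: "integrable lborel (\<lambda>x::'a. \<Prod>b\<in>Basis. g b (x \<bullet> b))"
    and integral_prod_Basis: "(LINT x::'a|lborel. (\<Prod>b\<in>Basis. g b (x \<bullet> b))) = (\<Prod>b\<in>Basis. LINT t|lborel. g b t)"
proof -
  interpret product_sigma_finite "\<lambda>b::'a. lborel :: real measure" ..
  have m: "(\<lambda>x::'a. \<Prod>b\<in>Basis. g b (x \<bullet> b)) \<in> borel_measurable borel"
  proof (intro borel_measurable_prod)
    fix b :: 'a assume "b \<in> Basis"
    with g[THEN borel_measurable_integrable] have [measurable]: "g b \<in> borel_measurable borel" by simp
    show "(\<lambda>x::'a. g b (x \<bullet> b)) \<in> borel_measurable borel" by measurable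
  qed
  have T: "(\<lambda>f. \<Sum>b\<in>Basis. f b *\<^sub>R b) \<in> measurable (\<Pi>\<^sub>M b\<in>(Basis::'a set). lborel :: real measure) (borel :: 'a measure)"
    by measurable
  have eq: "(\<Prod>b\<in>Basis. g b ((\<Sum>b'\<in>Basis. f b' *\<^sub>R b') \<bullet> b)) = (\<Prod>b\<in>(Basis::'a set). g b (f b))" for f :: "'a \<Rightarrow> real"
    by (intro prod.cong) auto
  show "integrable lborel (\<lambda>x::'a. \<Prod>b\<in>Basis. g b (x \<bullet> b))"
    unfolding lborel_eq[where 'a='a] integrable_distr_eq[OF T m] eq
    by (intro product_integrable_prod) (auto intro: g)
  show "(LINT x::'a|lborel. (\<Prod>b\<in>Basis. g b (x \<bullet> b))) = (\<Prod>b\<in>Basis. LINT t|lborel. g b t)"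
    unfolding lborel_eq[where 'a='a] integral_distr[OF T m] eq
    by (intro product_integral_prod) (auto intro: g)
qed

lemma std_normal_fourier:
  "(LINT x|lborel. complex_of_real (std_normal_density x) * exp (- (\<i> * complex_of_real (x * t)))) = exp (- complex_of_real (t\<^sup>2 / 2))"
proof -
  have "char std_normal_distribution (- t) = exp (- complex_of_real (t\<^sup>2 / 2))"
    by (simp add: char_std_normal_distribution exp_of_real[symmetric])
  also have "char std_normal_distribution (- t) =
     (LINT x|lborel. std_normal_density x *\<^sub>R exp (\<i> * complex_of_real (- t * x)))"
    unfolding char_def by (subst integral_density) auto
  finally show ?thesis by (simp add: scaleR_conv_of_real mult.commute)
qed

lemma integrable_std_normal_density: "integrable lborel std_normal_density"
  using integrable_normal_moment[of 1 0 0] by simp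

lemma integrable_gauss_density: "integrable lborel (gauss_density :: 'a::euclidean_space \<Rightarrow> real)"
  unfolding gauss_density_def[abs_def] by (intro integrable_prod_Basis integrable_std_normal_density)

lemma integral_gauss_density: "(LINT x::'a::euclidean_space|lborel. gauss_density x) = 1"
  unfolding gauss_density_def
  by (subst integral_prod_Basis[OF integrable_std_normal_density]) (auto intro!: prod.neutral integral_normal_density)

text \<open>
  The one-dimensional case is the characteristic function of the standard normal
  distribution.  The Gaussian is thus its own transform up to a constant; this explicit instance of inversion
  is the seed of the general one.
\<close>

lemma gauss_fourier:
  "(LINT x::'a::euclidean_space|lborel. complex_of_real (gauss_density x) * exp (- (\<i> * complex_of_real (x \<bullet> \<xi>))))
    = complex_of_real (exp (- (norm \<xi>)\<^sup>2 / 2))"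
proof -
  have ex: "exp (- (\<i> * complex_of_real (x \<bullet> \<xi>))) = (\<Prod>b\<in>Basis. exp (- (\<i> * complex_of_real ((x \<bullet> b) * (\<xi> \<bullet> b)))))" for x
    by (subst euclidean_inner) (simp add: exp_sum[symmetric] sum_negf sum_distrib_left)
  have "(LINT x::'a::euclidean_space|lborel. complex_of_real (gauss_density x) * exp (- (\<i> * complex_of_real (x \<bullet> \<xi>))))
     = (LINT x::'a|lborel. (\<Prod>b\<in>Basis. complex_of_real (std_normal_density (x \<bullet> b)) * exp (- (\<i> * complex_of_real ((x \<bullet> b) * (\<xi> \<bullet> b))))))"
    by (simp add: ex gauss_density_def prod.distrib)
  also have "\<dots> = (\<Prod>b\<in>Basis. LINT t|lborel. complex_of_real (std_normal_density t) * exp (- (\<i> * complex_of_real (t * (\<xi> \<bullet> b)))))"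
    by (rule integral_prod_Basis)
      (rule Bochner_Integration.integrable_bound[OF integrable_std_normal_density], auto simp: norm_mult)
  also have "\<dots> = (\<Prod>b\<in>Basis. exp (- complex_of_real ((\<xi> \<bullet> b)\<^sup>2 / 2)))"
    by (simp only: std_normal_fourier)
  also have "\<dots> = exp (- complex_of_real ((norm \<xi>)\<^sup>2 / 2))"
  proof -
    have "(norm \<xi>)\<^sup>2 = (\<Sum>b\<in>Basis. (\<xi> \<bullet> b)\<^sup>2)"
      by (subst power2_norm_eq_inner, subst euclidean_inner) (simp add: power2_eq_square)
    then show ?thesis by (simp add: exp_sum[symmetric] sum_negf sum_divide_distrib[symmetric])
  qed
  finally show ?thesis by (simp add: exp_of_real[symmetric])
qed

section \<open>The Fourier inversion bound\<close>

lemma integrable_gauss_mult: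
  fixes f :: "'a::euclidean_space \<Rightarrow> complex"
  assumes f: "integrable lborel f"
  shows "integrable lborel (\<lambda>x. complex_of_real (gauss_density x) * f x)"
proof -
  note [measurable] = borel_measurable_integrable[OF f]
  have le: "gauss_density z \<le> (1 / sqrt (2 * pi)) ^ DIM('a)" for z :: 'a
    unfolding gauss_density_eq by (intro mult_left_le) auto
  have "integrable lborel (\<lambda>x. (1 / sqrt (2 * pi)) ^ DIM('a) *\<^sub>R f x)" using f by simp
  then show ?thesis
    by (rule Bochner_Integration.integrable_bound)
      (auto simp: norm_mult gauss_density_nonneg simp del: norm_scaleR intro!: mult_right_mono le, simp add: mult_right_mono le)
qed

text \<open>
  The convolution of \<open>f\<close> with a Gaussian of width \<open>\<epsilon>\<close>, written as an expectation so that
  \<open>\<epsilon>\<close> enters only through a translation of \<open>f\<close>.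
\<close>

definition gauss_mean :: "real \<Rightarrow> ('a::euclidean_space \<Rightarrow> complex) \<Rightarrow> 'a \<Rightarrow> complex" where
  "gauss_mean \<epsilon> f x = (LINT z|lborel. complex_of_real (gauss_density z) * f (x + \<epsilon> *\<^sub>R z))"

lemma integrable_gauss_mean_integrand:
  fixes f :: "'a::euclidean_space \<Rightarrow> complex"
  assumes f: "integrable lborel f" and e: "\<epsilon> \<noteq> 0"
  shows "integrable lborel (\<lambda>z. complex_of_real (gauss_density z) * f (x + \<epsilon> *\<^sub>R z))"
  using integrable_gauss_mult[OF integrable_affine[OF f e, of x]] by simp

text \<open>
  Replacing the Gaussian density by the Fourier integral that represents it and exchanging
  the integrals turns the mean of \<open>f\<close> into an integral of the transform of \<open>f\<close> against a bounded
  weight.  The powers of \<open>\<epsilon>\<close> from the two changes of variable cancel, hence the bound is uniform in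
  \<open>\<epsilon>\<close>.
\<close>

lemma norm_gauss_mean_le:
  fixes f :: "'a::euclidean_space \<Rightarrow> complex"
  assumes f: "integrable lborel f" and e: "\<epsilon> > 0" and ff: "integrable lborel (fourier f)"
  shows "norm (gauss_mean \<epsilon> f x) \<le> (LINT \<xi>|lborel. norm (fourier f \<xi>)) / (2 * pi) ^ DIM('a)"
proof -
  let ?c = "(1 / sqrt (2 * pi)) ^ DIM('a)"
  let ?E = "\<lambda>t. exp (- (\<i> * complex_of_real t))"
  define g where "g z = f (x + \<epsilon> *\<^sub>R z)" for z
  have g: "integrable lborel g" unfolding g_def using integrable_affine[OF f, of \<epsilon> x] e by simp
  note [measurable] = borel_measurable_integrable[OF f] borel_measurable_integrable[OF g]
  have gd: "complex_of_real (gauss_density z) = ?c * (LINT w|lborel. complex_of_real (gauss_density w) * ?E (w \<bullet> z))" for z :: 'a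
    by (subst gauss_fourier) (simp add: gauss_density_eq)
  have int: "integrable (lborel \<Otimes>\<^sub>M lborel) (\<lambda>(z, w). g z * (complex_of_real (gauss_density w) * ?E (w \<bullet> z)))"
  proof (rule lborel_pair.Fubini_integrable)
    show "integrable lborel (\<lambda>z. LINT w|lborel. norm (case (z, w) of (z, w) \<Rightarrow> g z * (complex_of_real (gauss_density w) * ?E (w \<bullet> z))))"
      using g by (simp add: norm_mult gauss_density_nonneg integral_gauss_density)
    show "AE z in lborel. integrable lborel (\<lambda>w. case (z, w) of (z, w) \<Rightarrow> g z * (complex_of_real (gauss_density w) * ?E (w \<bullet> z)))"
      using integrable_fourier_integrand[OF integrable_of_real[OF integrable_gauss_density[where 'a='a]]]
      by (auto intro!: AE_I2)
  qed measurable
  have inner: "norm (LINT z|lborel. g z * ?E (w \<bullet> z)) = norm (fourier f ((1/\<epsilon>) *\<^sub>R w)) / \<epsilon> ^ DIM('a)" for w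
  proof -
    have "fourier f ((1/\<epsilon>) *\<^sub>R w) = \<epsilon> ^ DIM('a) *\<^sub>R (LINT z|lborel. g z * ?E ((x + \<epsilon> *\<^sub>R z) \<bullet> ((1/\<epsilon>) *\<^sub>R w)))"
      using e unfolding g_def
      by (subst fourier_lborel, simp, subst integral_affine[where c=\<epsilon> and t=x]) auto
    also have "(\<lambda>z. g z * ?E ((x + \<epsilon> *\<^sub>R z) \<bullet> ((1/\<epsilon>) *\<^sub>R w))) = (\<lambda>z. ?E (x \<bullet> w / \<epsilon>) * (g z * ?E (w \<bullet> z)))"
    proof
      fix z
      have "(x + \<epsilon> *\<^sub>R z) \<bullet> ((1/\<epsilon>) *\<^sub>R w) = x \<bullet> w / \<epsilon> + w \<bullet> z"
        using e by (simp add: inner_add_left inner_commute[of w] divide_simps)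
      then show "g z * ?E ((x + \<epsilon> *\<^sub>R z) \<bullet> ((1/\<epsilon>) *\<^sub>R w)) = ?E (x \<bullet> w / \<epsilon>) * (g z * ?E (w \<bullet> z))"
        by (simp add: exp_add[symmetric] algebra_simps)
    qed
    finally show ?thesis using e by (simp add: norm_mult)
  qed
  have "gauss_mean \<epsilon> f x = ?c * (LINT z|lborel. LINT w|lborel. g z * (complex_of_real (gauss_density w) * ?E (w \<bullet> z)))"
  proof -
    have "complex_of_real (gauss_density z) * f (x + \<epsilon> *\<^sub>R z)
        = ?c * (LINT w|lborel. g z * (complex_of_real (gauss_density w) * ?E (w \<bullet> z)))" for z
      unfolding g_def integral_mult_right_zero by (subst gd) simp
    then show ?thesis by (simp only: gauss_mean_def integral_mult_right_zero)
  qed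
  also have "(LINT z|lborel. LINT w|lborel. g z * (complex_of_real (gauss_density w) * ?E (w \<bullet> z)))
      = (LINT w|lborel. LINT z|lborel. g z * (complex_of_real (gauss_density w) * ?E (w \<bullet> z)))"
    using lborel_pair.Fubini_integral[OF int] by simp
  also have "\<dots> = (LINT w|lborel. complex_of_real (gauss_density w) * (LINT z|lborel. g z * ?E (w \<bullet> z)))"
  proof (rule Bochner_Integration.integral_cong[OF refl])
    fix w :: 'a
    have "(LINT z|lborel. g z * (complex_of_real (gauss_density w) * ?E (w \<bullet> z)))
        = (LINT z|lborel. complex_of_real (gauss_density w) * (g z * ?E (w \<bullet> z)))"
      by (intro Bochner_Integration.integral_cong refl mult.left_commute)
    then show "(LINT z|lborel. g z * (complex_of_real (gauss_density w) * ?E (w \<bullet> z)))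
        = complex_of_real (gauss_density w) * (LINT z|lborel. g z * ?E (w \<bullet> z))"
      by (simp only: integral_mult_right_zero)
  qed
  finally have "norm (gauss_mean \<epsilon> f x) = ?c * norm (LINT w|lborel. complex_of_real (gauss_density w) * (LINT z|lborel. g z * ?E (w \<bullet> z)))"
    by (simp add: norm_mult norm_power norm_divide)
  also have "\<dots> \<le> ?c * (LINT w|lborel. norm (complex_of_real (gauss_density w) * (LINT z|lborel. g z * ?E (w \<bullet> z))))"
    by (intro mult_left_mono integral_norm_bound) auto
  also have "\<dots> \<le> ?c * (LINT w|lborel. ?c / \<epsilon> ^ DIM('a) * norm (fourier f ((1/\<epsilon>) *\<^sub>R w)))"
  proof (intro mult_left_mono integral_mono')
    show "integrable lborel (\<lambda>w. ?c / \<epsilon> ^ DIM('a) * norm (fourier f ((1/\<epsilon>) *\<^sub>R w)))"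
      using integrable_affine[OF ff, of "1/\<epsilon>" 0] e by auto
    fix w :: 'a
    have "gauss_density w \<le> ?c" unfolding gauss_density_eq by (intro mult_left_le) auto
    then show "norm (complex_of_real (gauss_density w) * (LINT z|lborel. g z * ?E (w \<bullet> z)))
        \<le> ?c / \<epsilon> ^ DIM('a) * norm (fourier f ((1/\<epsilon>) *\<^sub>R w))"
      using e by (auto simp: norm_mult inner gauss_density_nonneg intro!: divide_right_mono mult_right_mono)
    show "0 \<le> ?c / \<epsilon> ^ DIM('a) * norm (fourier f ((1/\<epsilon>) *\<^sub>R w))" using e by simp
  qed auto
  also have "\<dots> = ?c * ?c * ((1/\<epsilon>) ^ DIM('a) * (LINT w|lborel. norm (fourier f (0 + (1/\<epsilon>) *\<^sub>R w))))"
    by (simp add: power_one_over)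
  also have "(1/\<epsilon>) ^ DIM('a) * (LINT w|lborel. norm (fourier f (0 + (1/\<epsilon>) *\<^sub>R w))) = (LINT \<xi>|lborel. norm (fourier f \<xi>))"
    using integral_affine[of "\<lambda>\<xi>. norm (fourier f \<xi>)" "1/\<epsilon>" 0] e borel_measurable_fourier[OF f] by simp
  also have "?c * ?c = 1 / (2 * pi) ^ DIM('a)"
    unfolding power_mult_distrib[symmetric] by (simp add: power_one_over)
  finally show ?thesis by simp
qed

text \<open>
  The distance of the mean to \<open>f\<close> is at most the Gaussian average of the \<open>L\<^sup>1\<close> distances
  between \<open>f\<close> and its translates by \<open>\<epsilon>\<^sub>n z\<close>, each of which tends to zero.
\<close>

lemma gauss_mean_L1_tendsto:
  fixes f :: "'a::euclidean_space \<Rightarrow> complex"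
  assumes f: "integrable lborel f" and e: "\<And>n. \<epsilon> n > 0" "\<epsilon> \<longlonglongrightarrow> 0"
  shows "integrable lborel (\<lambda>x. gauss_mean (\<epsilon> n) f x - f x)"
    and "(\<lambda>n. LINT x|lborel. norm (gauss_mean (\<epsilon> n) f x - f x)) \<longlonglongrightarrow> 0"
proof -
  note [measurable] = borel_measurable_integrable[OF f]
  have fs: "integrable lborel (\<lambda>x. f (x + h))" for h using f by (rule integrable_translate)
  define D where "D n z = (LINT x|lborel. norm (f (x + \<epsilon> n *\<^sub>R z) - f x))" for n z
  have D_le: "D n z \<le> 2 * (LINT x|lborel. norm (f x))" for n z
  proof -
    have "D n z \<le> (LINT x|lborel. norm (f (x + \<epsilon> n *\<^sub>R z)) + norm (f x))"
      unfolding D_def using fs f by (intro integral_mono norm_triangle_ineq4) auto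
    also have "\<dots> = 2 * (LINT x|lborel. norm (f x))"
      using fs f integral_translate[of "\<lambda>x. norm (f x)" "\<epsilon> n *\<^sub>R z"] by simp
    finally show ?thesis .
  qed
  have D_nonneg: "D n z \<ge> 0" for n z by (simp add: D_def)
  have [measurable]: "D n \<in> borel_measurable lborel" for n
    unfolding D_def by measurable
  have iGD: "integrable lborel (\<lambda>z. gauss_density z * D n z)" for n
  proof (rule Bochner_Integration.integrable_bound)
    show "integrable lborel (\<lambda>z::'a. gauss_density z * (2 * (LINT x|lborel. norm (f x))))"
      using integrable_gauss_density[where 'a='a] by simp
  qed (auto intro!: AE_I2 mult_left_mono D_le simp: abs_mult gauss_density_nonneg D_nonneg)
  have int: "integrable (lborel \<Otimes>\<^sub>M lborel) (\<lambda>(z, x). complex_of_real (gauss_density z) * (f (x + \<epsilon> n *\<^sub>R z) - f x))" for n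
  proof (rule lborel_pair.Fubini_integrable)
    show "integrable lborel (\<lambda>z. LINT x|lborel. norm (case (z, x) of (z, x) \<Rightarrow> complex_of_real (gauss_density z) * (f (x + \<epsilon> n *\<^sub>R z) - f x)))"
      using iGD[of n] by (simp add: norm_mult gauss_density_nonneg D_def)
    show "AE z in lborel. integrable lborel (\<lambda>x. case (z, x) of (z, x) \<Rightarrow> complex_of_real (gauss_density z) * (f (x + \<epsilon> n *\<^sub>R z) - f x))"
      using f fs by (auto intro!: AE_I2)
  qed measurable
  have eq: "gauss_mean (\<epsilon> n) f x - f x = (LINT z|lborel. complex_of_real (gauss_density z) * (f (x + \<epsilon> n *\<^sub>R z) - f x))" for n x
  proof -
    have "(LINT z::'a|lborel. complex_of_real (gauss_density z) * f x) = (LINT z::'a|lborel. complex_of_real (gauss_density z)) * f x"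
      by simp
    also have "\<dots> = f x"
      by (subst integral_complex_of_real) (simp add: integral_gauss_density)
    finally show ?thesis
      unfolding gauss_mean_def right_diff_distrib
      using e(1)[of n] integrable_gauss_mean_integrand[OF f, of "\<epsilon> n" x] integrable_of_real[OF integrable_gauss_density, where 'a=complex]
      by (subst Bochner_Integration.integral_diff) auto
  qed
  show "integrable lborel (\<lambda>x. gauss_mean (\<epsilon> n) f x - f x)" for n
    unfolding eq using lborel_pair.integrable_snd[OF int[of n]] by simp
  have le: "(LINT x|lborel. norm (gauss_mean (\<epsilon> n) f x - f x)) \<le> (LINT z|lborel. gauss_density z * D n z)" for n
  proof -
    have i: "integrable (lborel \<Otimes>\<^sub>M lborel) (\<lambda>(z, x). norm (complex_of_real (gauss_density z) * (f (x + \<epsilon> n *\<^sub>R z) - f x)))"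
      using integrable_norm[OF int[of n]] by (simp add: case_prod_unfold)
    have "(LINT x|lborel. norm (gauss_mean (\<epsilon> n) f x - f x)) \<le>
        (LINT x|lborel. LINT z|lborel. norm (complex_of_real (gauss_density z) * (f (x + \<epsilon> n *\<^sub>R z) - f x)))"
      unfolding eq
    proof (intro integral_mono integral_norm_bound)
      show "integrable lborel (\<lambda>x. norm (LINT z|lborel. complex_of_real (gauss_density z) * (f (x + \<epsilon> n *\<^sub>R z) - f x)))"
        using integrable_norm[OF lborel_pair.integrable_snd[OF int[of n]]] by simp
      show "integrable lborel (\<lambda>x. LINT z|lborel. norm (complex_of_real (gauss_density z) * (f (x + \<epsilon> n *\<^sub>R z) - f x)))"
        using lborel_pair.integrable_snd[OF i] by simp
    qed
    also have "\<dots> = (LINT z|lborel. LINT x|lborel. norm (complex_of_real (gauss_density z) * (f (x + \<epsilon> n *\<^sub>R z) - f x)))"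
      using lborel_pair.Fubini_integral[OF i] by simp
    also have "\<dots> = (LINT z|lborel. gauss_density z * D n z)"
      by (simp add: norm_mult gauss_density_nonneg D_def)
    finally show ?thesis .
  qed
  have "(\<lambda>n. LINT z|lborel. gauss_density z * D n z) \<longlonglongrightarrow> (LINT z::'a|lborel. 0)"
  proof (rule integral_dominated_convergence[where w = "\<lambda>z. gauss_density z * (2 * (LINT x|lborel. norm (f x)))"])
    show "AE z in lborel. (\<lambda>n. gauss_density z * D n z) \<longlonglongrightarrow> 0"
    proof (intro AE_I2)
      fix z :: 'a
      have "(\<lambda>n. \<epsilon> n *\<^sub>R z) \<longlonglongrightarrow> 0 *\<^sub>R z" by (intro tendsto_intros e)
      then have "(\<lambda>n. gauss_density z * D n z) \<longlonglongrightarrow> gauss_density z * 0"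
        unfolding D_def by (intro tendsto_mult tendsto_const L1_translation_continuous f) simp
      then show "(\<lambda>n. gauss_density z * D n z) \<longlonglongrightarrow> 0" by simp
    qed
  qed (use integrable_gauss_density[where 'a='a] in \<open>auto intro!: AE_I2 mult_left_mono D_le simp: abs_mult gauss_density_nonneg D_nonneg\<close>)
  then have 0: "(\<lambda>n. LINT z|lborel. gauss_density z * D n z) \<longlonglongrightarrow> 0" by simp
  show "(\<lambda>n. LINT x|lborel. norm (gauss_mean (\<epsilon> n) f x - f x)) \<longlonglongrightarrow> 0"
    by (rule Lim_null_comparison[OF _ 0]) (auto intro!: always_eventually le)
qed

text \<open>
  The Gaussian means satisfy the bound everywhere and converge to \<open>f\<close> almost everywhere along
  a subsequence.  This is the only consequence of Fourier inversion used below.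
\<close>

theorem AE_norm_le_fourier_integral:
  fixes f :: "'a::euclidean_space \<Rightarrow> complex"
  assumes f: "integrable lborel f" and ff: "integrable lborel (fourier f)"
  shows "AE x in lborel. norm (f x) \<le> (LINT \<xi>|lborel. norm (fourier f \<xi>)) / (2 * pi) ^ DIM('a)"
proof -
  define \<epsilon> :: "nat \<Rightarrow> real" where "\<epsilon> n = 1 / real (Suc n)" for n
  have e: "\<And>n. \<epsilon> n > 0" "\<epsilon> \<longlonglongrightarrow> 0"
    unfolding \<epsilon>_def[abs_def] using LIMSEQ_inverse_real_of_nat by (auto simp: inverse_eq_divide)
  note L = gauss_mean_L1_tendsto[OF f e]
  from tendsto_L1_AE_subseq[OF L] obtain r :: "nat \<Rightarrow> nat" where
    "AE x in lborel. (\<lambda>n. gauss_mean (\<epsilon> (r n)) f x - f x) \<longlonglongrightarrow> 0" by blast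
  then show ?thesis
  proof eventually_elim
    case (elim x)
    then have "(\<lambda>n. gauss_mean (\<epsilon> (r n)) f x) \<longlonglongrightarrow> f x" by (rule LIM_zero_cancel)
    then have "(\<lambda>n. norm (gauss_mean (\<epsilon> (r n)) f x)) \<longlonglongrightarrow> norm (f x)" by (rule tendsto_norm)
    then show ?case
      by (rule LIMSEQ_le_const2) (use norm_gauss_mean_le[OF f e(1) ff] in blast)
  qed
qed

section \<open>Borel representatives of Lebesgue measurable functions\<close>

text \<open>
  Since \<open>lebesgue\<close> is complete, agreement almost everywhere with a Borel function makes \<open>g\<close>
  measurable.
\<close>

lemma borel_representative:
  fixes f :: "'a::euclidean_space \<Rightarrow> 'b::{banach, second_countable_topology}"
  assumes [measurable]: "f \<in> borel_measurable borel" and ae: "AE x in lborel. g x = f x"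
  shows borel_measurable_lebesgue_rep: "g \<in> borel_measurable lebesgue"
    and integrable_lebesgue_rep: "integrable lebesgue g \<longleftrightarrow> integrable lborel f"
    and integral_lebesgue_rep: "(LINT x|lebesgue. g x) = (LINT x|lborel. f x)"
proof -
  have f: "f \<in> borel_measurable lebesgue" by (simp add: measurable_completion)
  have ae': "AE x in lebesgue. g x = f x" using ae by (rule AE_completion)
  show g: "g \<in> borel_measurable lebesgue"
  proof (rule measurableI)
    fix A :: "'b set" assume A: "A \<in> sets borel"
    have fA: "f -` A \<inter> space lebesgue \<in> sets lebesgue" using f A by (rule measurable_sets)
    have eq: "AE x in lebesgue. x \<in> f -` A \<inter> space lebesgue \<longleftrightarrow> x \<in> g -` A \<inter> space lebesgue"
      using ae' by eventually_elim auto
    show "g -` A \<inter> space lebesgue \<in> sets lebesgue"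
      by (rule completion.in_sets_AE[OF eq fA]) simp
  qed simp
  show "integrable lebesgue g \<longleftrightarrow> integrable lborel f"
    using integrable_cong_AE[OF g f ae'] by (simp add: integrable_completion)
  show "(LINT x|lebesgue. g x) = (LINT x|lborel. f x)"
    using integral_cong_AE[OF g f ae'] by (simp add: integral_completion)
qed

lemma ex_borel_rep_real:
  fixes f :: "'a::euclidean_space \<Rightarrow> real"
  assumes "integrable lebesgue f"
  obtains g where "integrable lborel g" "AE x in lborel. f x = g x"
proof -
  obtain g where g: "g \<in> borel_measurable lborel" "AE x in lborel. f x = g x"
    using completion_ex_borel_measurable_real[of f lborel] assms by auto
  then have "integrable lborel g" using integrable_lebesgue_rep[of g f] assms by simp
  then show thesis using that g by blast
qed

lemma ex_borel_rep_complex: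
  fixes f :: "'a::euclidean_space \<Rightarrow> complex"
  assumes f: "integrable lebesgue f"
  obtains g where "integrable lborel g" "AE x in lborel. f x = g x"
proof -
  obtain g h where g: "integrable lborel g" "AE x in lborel. Re (f x) = g x"
      and h: "integrable lborel h" "AE x in lborel. Im (f x) = h x"
    using ex_borel_rep_real[of "\<lambda>x. Re (f x)"] ex_borel_rep_real[of "\<lambda>x. Im (f x)"] f
    by (metis integrable_Re integrable_Im)
  show thesis
  proof (rule that[of "\<lambda>x. complex_of_real (g x) + \<i> * complex_of_real (h x)"])
    show "integrable lborel (\<lambda>x. complex_of_real (g x) + \<i> * complex_of_real (h x))"
      using g(1) h(1) by auto
    show "AE x in lborel. f x = complex_of_real (g x) + \<i> * complex_of_real (h x)"
      using g(2) h(2) by eventually_elim (simp add: complex_eq_iff)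
  qed
qed

lemma AE_reflect:
  fixes P :: "'a::euclidean_space \<Rightarrow> bool"
  assumes "AE y in lborel. P y"
  shows "AE y in lborel. P (x - y)"
proof -
  obtain N where N: "N \<in> null_sets lborel" "{y. \<not> P y} \<subseteq> N"
    using assms by (auto elim!: AE_E simp: null_sets_def)
  then have [measurable]: "N \<in> sets borel" by auto
  have "AE y in (lborel :: 'a measure). y \<notin> N" using N(1) by (rule AE_not_in)
  moreover have "lborel = distr lborel borel (\<lambda>y. x - y)"
    using lborel_affine[of "- 1" x] by (simp add: density_1)
  ultimately have "AE y in distr lborel borel (\<lambda>y. x - y). y \<notin> N" by (simp only:)
  then have "AE y in lborel. x - y \<notin> N" by (subst (asm) AE_distr_iff) auto
  then show ?thesis using N(2) by (auto elim!: AE_mp)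
qed

lemma fourier_rep:
  assumes "f \<in> borel_measurable borel" and "AE x in lborel. g x = f x"
  shows "fourier g \<xi> = fourier f \<xi>"
proof -
  have "(\<lambda>x. f x * exp (- (\<i> * complex_of_real (x \<bullet> \<xi>)))) \<in> borel_measurable borel"
    using assms(1) by measurable
  moreover have "AE x in lborel. g x * exp (- (\<i> * complex_of_real (x \<bullet> \<xi>))) = f x * exp (- (\<i> * complex_of_real (x \<bullet> \<xi>)))"
    using assms(2) by eventually_elim simp
  ultimately show ?thesis
    unfolding fourier_lborel[OF assms(1)] unfolding fourier_def by (rule integral_lebesgue_rep)
qed

text \<open>
  A null set in either argument does not change the integral that defines the convolution at any
  given point.  Hence convolving representatives gives the same function everywhere, not merely
  almost everywhere.
\<close>

lemma conv_op_rep: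
  fixes J :: "'a::euclidean_space \<Rightarrow> real"
  assumes [measurable]: "J' \<in> borel_measurable borel" "u' \<in> borel_measurable borel"
    and "AE x in lborel. J x = J' x" "AE x in lborel. u x = u' x"
  shows "conv_op J u = conv_op J' u'"
    and "conv_op J u x = (LINT y|lborel. complex_of_real (J' (x - y)) * u' y)"
proof -
  have m: "(\<lambda>y. complex_of_real (J' (x - y)) * u' y) \<in> borel_measurable borel" for x by measurable
  have *: "conv_op J u x = (LINT y|lborel. complex_of_real (J' (x - y)) * u' y)"
    if "AE x in lborel. J x = J' x" "AE x in lborel. u x = u' x" for J u x
    unfolding conv_op_def
    by (rule integral_lebesgue_rep[OF m], use AE_reflect[OF that(1), of x] that(2) in eventually_elim) simp
  show "conv_op J u x = (LINT y|lborel. complex_of_real (J' (x - y)) * u' y)" using * assms by blast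
  show "conv_op J u = conv_op J' u'" using *[OF assms(3,4)] *[of J' u'] by auto
qed

section \<open>Convolution\<close>

lemma
  fixes J :: "'a::euclidean_space \<Rightarrow> real"
  assumes J: "integrable lborel J" and u: "integrable lborel u"
  shows integrable_conv_op: "integrable lborel (conv_op J u)"
    and integral_norm_conv_op_le: "(LINT x|lborel. norm (conv_op J u x)) \<le> (LINT x|lborel. norm (J x)) * (LINT x|lborel. norm (u x))"
    and fourier_conv_op: "fourier (conv_op J u) \<xi> = fourier (\<lambda>x. complex_of_real (J x)) \<xi> * fourier u \<xi>"
proof -
  note [measurable] = borel_measurable_integrable[OF J] borel_measurable_integrable[OF u]
  let ?J = "\<lambda>x. complex_of_real (J x)"
  let ?E = "\<lambda>x. exp (- (\<i> * complex_of_real (x \<bullet> \<xi>)))"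
  have Js: "integrable lborel (\<lambda>x. J (x - y))" for y using integrable_translate[OF J, of "- y"] by simp
  have Jn: "(LINT x|lborel. norm (J (x - y))) = (LINT x|lborel. norm (J x))" for y
    using integral_translate[of "\<lambda>x. norm (J x)" "- y"] by simp
  have c: "conv_op J u x = (LINT y|lborel. ?J (x - y) * u y)" for x
    by (rule conv_op_rep(2)) auto
  have int: "integrable (lborel \<Otimes>\<^sub>M lborel) (\<lambda>(y, x). ?J (x - y) * u y)"
  proof (rule lborel_pair.Fubini_integrable)
    show "integrable lborel (\<lambda>y. LINT x|lborel. norm (case (y, x) of (y, x) \<Rightarrow> ?J (x - y) * u y))"
      using u Jn by (simp add: norm_mult)
    show "AE y in lborel. integrable lborel (\<lambda>x. case (y, x) of (y, x) \<Rightarrow> ?J (x - y) * u y)"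
      using Js by (auto intro!: AE_I2)
  qed measurable
  have intE: "integrable (lborel \<Otimes>\<^sub>M lborel) (\<lambda>(y, x). ?J (x - y) * u y * ?E x)"
    by (rule Bochner_Integration.integrable_bound[OF int]) (auto simp: norm_mult)
  have intn: "integrable (lborel \<Otimes>\<^sub>M lborel) (\<lambda>(y, x). norm (?J (x - y) * u y))"
    using integrable_norm[OF int] by (simp add: case_prod_unfold)
  show ic: "integrable lborel (conv_op J u)"
    using lborel_pair.integrable_snd[OF int] by (simp add: c[abs_def])
  have "(LINT x|lborel. norm (conv_op J u x)) \<le> (LINT x|lborel. LINT y|lborel. norm (?J (x - y) * u y))"
    using lborel_pair.integrable_snd[OF intn] ic unfolding c
    by (intro integral_mono integral_norm_bound) (auto simp: c[abs_def])
  also have "\<dots> = (LINT y|lborel. LINT x|lborel. norm (?J (x - y) * u y))"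
    using lborel_pair.Fubini_integral[OF intn] by simp
  also have "\<dots> = (LINT x|lborel. norm (J x)) * (LINT x|lborel. norm (u x))"
    using Jn by (simp add: norm_mult)
  finally show "(LINT x|lborel. norm (conv_op J u x)) \<le> (LINT x|lborel. norm (J x)) * (LINT x|lborel. norm (u x))" .
  have inner: "(LINT x|lborel. ?J (x - y) * u y * ?E x) = fourier ?J \<xi> * (u y * ?E y)" for y
  proof -
    have "(LINT x|lborel. ?J (x - y) * u y * ?E x) = (LINT x|lborel. ?J (x + y - y) * u y * ?E (x + y))"
      by (rule integral_translate[symmetric]) measurable
    also have "\<dots> = (LINT x|lborel. (?J x * ?E x) * (u y * ?E y))"
      by (simp add: inner_add_left distrib_left exp_add exp_diff exp_minus divide_inverse mult_ac)
    also have "\<dots> = fourier ?J \<xi> * (u y * ?E y)"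
      by (subst fourier_lborel) auto
    finally show ?thesis .
  qed
  have "fourier (conv_op J u) \<xi> = (LINT x|lborel. LINT y|lborel. ?J (x - y) * u y * ?E x)"
    using borel_measurable_integrable[OF ic] by (simp add: fourier_lborel c)
  also have "\<dots> = (LINT y|lborel. LINT x|lborel. ?J (x - y) * u y * ?E x)"
    using lborel_pair.Fubini_integral[OF intE] by simp
  also have "\<dots> = fourier ?J \<xi> * fourier u \<xi>"
    by (simp add: inner fourier_lborel)
  finally show "fourier (conv_op J u) \<xi> = fourier ?J \<xi> * fourier u \<xi>" .
qed

section \<open>The Riemann--Lebesgue lemma and the spectral gap\<close>

lemma fourier_translate:
  assumes f: "f \<in> borel_measurable borel"
  shows "fourier (\<lambda>x. f (x + h)) \<xi> = exp (\<i> * complex_of_real (h \<bullet> \<xi>)) * fourier f \<xi>"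
proof -
  note [measurable] = f
  have "fourier f \<xi> = (LINT x|lborel. f (x + h) * exp (- (\<i> * complex_of_real ((x + h) \<bullet> \<xi>))))"
    by (subst fourier_lborel[OF f], rule integral_translate[symmetric]) measurable
  also have "\<dots> = (LINT x|lborel. exp (- (\<i> * complex_of_real (h \<bullet> \<xi>))) * (f (x + h) * exp (- (\<i> * complex_of_real (x \<bullet> \<xi>)))))"
    by (simp add: inner_add_left distrib_left exp_add exp_diff exp_minus divide_inverse mult_ac)
  also have "\<dots> = exp (- (\<i> * complex_of_real (h \<bullet> \<xi>))) * fourier (\<lambda>x. f (x + h)) \<xi>"
    by (subst fourier_lborel) auto
  finally show ?thesis by (simp add: exp_minus)
qed

text \<open>
  Translating \<open>f\<close> by \<open>h = \<pi> \<xi> / |\<xi>|\<^sup>2\<close> changes the sign of its transform at \<open>\<xi>\<close>, so that twice the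
  transform is bounded by the \<open>L\<^sup>1\<close> distance of \<open>f\<close> to its translate, and \<open>|h| = \<pi> / |\<xi>|\<close> tends to zero.
\<close>

theorem Riemann_Lebesgue:
  fixes f :: "'a::euclidean_space \<Rightarrow> complex"
  assumes f: "integrable lborel f" and X: "filterlim (\<lambda>n. norm (X n)) at_top sequentially"
  shows "(\<lambda>n. fourier f (X n)) \<longlonglongrightarrow> 0"
proof -
  note [measurable] = borel_measurable_integrable[OF f]
  \<comment> \<open>The shift satisfies \<open>h\<^sub>n \<bullet> X\<^sub>n = \<pi>\<close>, so the character \<open>exp (\<i> h\<^sub>n \<bullet> X\<^sub>n)\<close> equals \<open>-1\<close>.\<close>
  define h where "h n = (pi / (norm (X n))\<^sup>2) *\<^sub>R X n" for n
  have nh: "norm (h n) = pi * inverse (norm (X n))" for n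
    by (cases "X n = 0") (auto simp: h_def power2_eq_square field_simps)
  have "(\<lambda>n. pi * inverse (norm (X n))) \<longlonglongrightarrow> pi * 0"
    by (rule tendsto_mult[OF tendsto_const tendsto_inverse_0_at_top[OF X]])
  then have "h \<longlonglongrightarrow> 0" by (subst tendsto_norm_zero_iff[symmetric]) (simp add: nh)
  then have "(\<lambda>n. (LINT x|lborel. norm (f (x + h n) - f x)) / 2) \<longlonglongrightarrow> 0 / 2"
    by (intro tendsto_divide L1_translation_continuous f) auto
  then have 0: "(\<lambda>n. (LINT x|lborel. norm (f (x + h n) - f x)) / 2) \<longlonglongrightarrow> 0" by simp
  show ?thesis
  proof (rule Lim_null_comparison[OF _ 0])
    have "eventually (\<lambda>n. norm (X n) > 0) sequentially"
      using X unfolding filterlim_at_top_dense by blast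
    then show "eventually (\<lambda>n. norm (fourier f (X n)) \<le> (LINT x|lborel. norm (f (x + h n) - f x)) / 2) sequentially"
    proof eventually_elim
      case (elim n)
      then have "h n \<bullet> X n = pi" by (simp add: h_def power2_norm_eq_inner)
      then have "fourier (\<lambda>x. f (x + h n)) (X n) = - fourier f (X n)"
        by (simp add: fourier_translate)
      moreover have "fourier (\<lambda>x. f (x + h n) - f x) (X n) = fourier (\<lambda>x. f (x + h n)) (X n) - fourier f (X n)"
        using integrable_fourier_integrand[OF f] integrable_fourier_integrand[OF integrable_translate[OF f]]
        by (simp add: fourier_lborel left_diff_distrib)
      ultimately have "norm (2 * fourier f (X n)) = norm (fourier (\<lambda>x. f (x + h n) - f x) (X n))"
        by (simp add: norm_minus_commute)
      also have "\<dots> \<le> (LINT x|lborel. norm (f (x + h n) - f x))"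
        using f integrable_translate[OF f] by (intro norm_fourier_le) auto
      finally show ?case by (simp add: norm_mult)
    qed
  qed
qed

text \<open>
  Modulus 1 at \<open>\<xi>\<close> would force \<open>cos (x \<bullet> \<xi> + \<theta>) = 1\<close> for almost every \<open>x\<close> with
  \<open>J x > 0\<close>, where \<open>\<theta>\<close> is the argument of the transform; these \<open>x\<close> lie on countably many parallel
  hyperplanes, a null set.
\<close>

lemma norm_fourier_density_less:
  fixes J :: "'a::euclidean_space \<Rightarrow> real"
  assumes J: "integrable lborel J" and nn: "AE x in lborel. J x \<ge> 0" and J1: "(LINT x|lborel. J x) = 1" and \<xi>: "\<xi> \<noteq> 0"
  shows "norm (fourier (\<lambda>x. complex_of_real (J x)) \<xi>) < 1"
proof (rule ccontr)
  note [measurable] = borel_measurable_integrable[OF J]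
  let ?E = "\<lambda>x. exp (- (\<i> * complex_of_real (x \<bullet> \<xi>)))"
  define F where "F = fourier (\<lambda>x. complex_of_real (J x)) \<xi>"
  assume "\<not> norm (fourier (\<lambda>x. complex_of_real (J x)) \<xi>) < 1"
  then have F1: "norm F \<ge> 1" by (simp add: F_def)
  define \<theta> where "\<theta> = Arg F"
  have F: "F = complex_of_real (norm F) * cis \<theta>"
    unfolding \<theta>_def using rcis_cmod_Arg[of F] by (simp add: rcis_def)
  have i1: "integrable lborel (\<lambda>x. complex_of_real (J x) * ?E x * cis (- \<theta>))"
    using integrable_fourier_integrand[OF integrable_of_real[OF J]] by auto
  have re: "Re (complex_of_real (J x) * ?E x * cis (- \<theta>)) = J x * cos (x \<bullet> \<xi> + \<theta>)" for x
  proof -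
    have "?E x = cis (- (x \<bullet> \<xi>))" by (simp add: cis_conv_exp)
    then have "complex_of_real (J x) * ?E x * cis (- \<theta>) = complex_of_real (J x) * cis (- (x \<bullet> \<xi> + \<theta>))"
      by (simp add: cis_mult algebra_simps)
    moreover have "cos (- (x \<bullet> \<xi> + \<theta>)) = cos (x \<bullet> \<xi> + \<theta>)" by (rule cos_minus)
    ultimately show ?thesis by (simp only: times_complex.sel complex_of_real_def complex.sel cis.sel mult_zero_left diff_zero)
  qed
  have ic: "integrable lborel (\<lambda>x. J x * cos (x \<bullet> \<xi> + \<theta>))"
    using integrable_Re[OF i1] by (simp only: re)
  have "(LINT x|lborel. J x * cos (x \<bullet> \<xi> + \<theta>)) = Re (LINT x|lborel. complex_of_real (J x) * ?E x * cis (- \<theta>))"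
    using integral_Re[OF i1] by (simp only: re)
  also have "(LINT x|lborel. complex_of_real (J x) * ?E x * cis (- \<theta>)) = F * cis (- \<theta>)"
    unfolding F_def by (subst fourier_lborel) auto
  also have "\<dots> = complex_of_real (norm F)" by (subst F) (simp add: cis_mult)
  finally have "(LINT x|lborel. J x - J x * cos (x \<bullet> \<xi> + \<theta>)) = 1 - norm F"
    using J ic J1 by simp
  moreover have nn': "AE x in lborel. 0 \<le> J x - J x * cos (x \<bullet> \<xi> + \<theta>)"
    using nn by eventually_elim (simp add: mult_left_le)
  ultimately have "(LINT x|lborel. J x - J x * cos (x \<bullet> \<xi> + \<theta>)) = 0"
    using F1 integral_nonneg_AE[OF nn'] by simp
  then have AE0: "AE x in lborel. J x - J x * cos (x \<bullet> \<xi> + \<theta>) = 0"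
    using integral_nonneg_eq_0_iff_AE[OF _ nn'] J ic by auto
  define S where "S = (\<Union>k::int. {x. \<xi> \<bullet> x = real_of_int k * 2 * pi - \<theta>})"
  have "negligible S" unfolding S_def
  proof (rule negligible_countable_Union)
    fix H assume "H \<in> range (\<lambda>k::int. {x. \<xi> \<bullet> x = real_of_int k * 2 * pi - \<theta>})"
    then obtain k :: int where H: "H = {x. \<xi> \<bullet> x = real_of_int k * 2 * pi - \<theta>}" by blast
    show "negligible H" unfolding H by (rule negligible_hyperplane) (simp add: \<xi>)
  qed simp
  then have "AE x in lborel. x \<notin> S"
    unfolding negligible_iff_null_sets by (rule AE_not_in[THEN AE_completion_iff[THEN iffD1]])
  then have "AE x in lborel. J x = 0"
    using AE0
  proof eventually_elim
    case (elim x)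
    show ?case
    proof (rule ccontr)
      assume "J x \<noteq> 0"
      with elim have "cos (x \<bullet> \<xi> + \<theta>) = 1" by auto
      then obtain k :: int where "x \<bullet> \<xi> + \<theta> = real_of_int k * 2 * pi" by (auto simp: cos_one_2pi_int)
      then have "x \<in> S" by (auto simp: S_def inner_commute algebra_simps)
      then show False using elim by simp
    qed
  qed
  then have "(LINT x|lborel. J x) = 0" by (rule integral_eq_zero_AE)
  then show False using J1 by simp
qed

text \<open>
  Riemann--Lebesgue handles large \<open>\<xi>\<close>; on the compact shell that remains the continuous modulus
  attains its maximum, which is below 1.
\<close>

theorem fourier_density_gap:
  fixes J :: "'a::euclidean_space \<Rightarrow> real"
  assumes J: "integrable lborel J" and nn: "AE x in lborel. J x \<ge> 0" and J1: "(LINT x|lborel. J x) = 1" and r: "r > 0"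
  obtains \<delta> where "\<delta> > 0" "\<And>\<xi>. norm \<xi> \<ge> r \<Longrightarrow> norm (fourier (\<lambda>x. complex_of_real (J x)) \<xi>) \<le> 1 - \<delta>"
proof -
  let ?F = "fourier (\<lambda>x. complex_of_real (J x))"
  have Jc: "integrable lborel (\<lambda>x. complex_of_real (J x))" using J by auto
  have "\<exists>R. \<forall>\<xi>. norm \<xi> \<ge> R \<longrightarrow> norm (?F \<xi>) \<le> 1 / 2"
  proof (rule ccontr)
    assume "\<not> ?thesis"
    then have "\<forall>n. \<exists>\<xi>. norm \<xi> \<ge> real n \<and> norm (?F \<xi>) > 1 / 2" by (meson not_le)
    then obtain X where X: "\<And>n. norm (X n) \<ge> real n" "\<And>n. norm (?F (X n)) > 1 / 2" by metis
    have "filterlim (\<lambda>n. norm (X n)) at_top sequentially"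
      using filterlim_real_sequentially by (rule filterlim_at_top_mono) (use X in auto)
    then have "(\<lambda>n. norm (?F (X n))) \<longlonglongrightarrow> 0" by (intro tendsto_norm_zero Riemann_Lebesgue Jc)
    then have "(1/2::real) \<le> 0" by (rule LIMSEQ_le_const) (use X(2) less_imp_le in blast)
    then show False by simp
  qed
  then obtain R where R: "\<And>\<xi>. norm \<xi> \<ge> R \<Longrightarrow> norm (?F \<xi>) \<le> 1 / 2" by blast
  define K :: "'a set" where "K = cball 0 R - ball 0 r"
  have cK: "compact K" unfolding K_def by (intro compact_diff) auto
  have contF: "continuous_on K (\<lambda>\<xi>. norm (?F \<xi>))"
    by (intro continuous_on_norm continuous_at_imp_continuous_on ballI isCont_fourier Jc)
  obtain m where m: "m < 1" "\<And>\<xi>. \<xi> \<in> K \<Longrightarrow> norm (?F \<xi>) \<le> m"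
  proof (cases "K = {}")
    case True
    then show thesis by (intro that[of 0]) auto
  next
    case False
    with continuous_attains_sup[OF cK _ contF] obtain \<xi>0 where
      x0: "\<xi>0 \<in> K" "\<And>\<xi>. \<xi> \<in> K \<Longrightarrow> norm (?F \<xi>) \<le> norm (?F \<xi>0)" by blast
    from x0(1) r have "\<xi>0 \<noteq> 0" by (auto simp: K_def)
    from norm_fourier_density_less[OF J nn J1 this] x0(2) show thesis by (rule that)
  qed
  show thesis
  proof (rule that[of "min (1/2) (1 - m)"])
    fix \<xi> :: 'a assume "norm \<xi> \<ge> r"
    then show "norm (?F \<xi>) \<le> 1 - min (1/2) (1 - m)"
      using R[of \<xi>] m(2)[of \<xi>] by (cases "norm \<xi> \<ge> R") (auto simp: K_def)
  qed (use m in auto)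
qed

section \<open>Laplace-type integrals with regularly varying exponent\<close>

lemma summable_exp_neg_mult_powr:
  "summable (\<lambda>k. exp (- real k) * (real k + 1) powr a)"
proof (rule summable_comparison_test_bigo)
  show "summable (\<lambda>k. norm (1 / real k ^ 2))"
    using inverse_power_summable[of 2, where 'a=real] by (simp add: inverse_eq_divide)
  show "(\<lambda>k. exp (- real k) * (real k + 1) powr a) \<in> O(\<lambda>k. 1 / real k ^ 2)" by real_asymp
qed

lemma term_le_suminf: "f k \<le> (\<Sum>k. f k :: ennreal)"
  using sum_le_suminf[of f "{k}"] by simp

text \<open>
  Slicing space by the integer part \<open>k\<close> of \<open>s |\<xi>|\<^sup>\<sigma>\<close> bounds the integral by a sum over balls of
  volume proportional to \<open>((k + 1) / s) powr (n / \<sigma>)\<close> with weights \<open>exp (-k)\<close>; the power of \<open>s\<close>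
  factors out of a convergent series.
\<close>

lemma integral_exp_neg_norm_powr_le:
  fixes \<sigma> :: real
  assumes \<sigma>: "\<sigma> > 0"
  obtains K where "K > 0"
    "\<And>s. s > 0 \<Longrightarrow> integrable lborel (\<lambda>\<xi>::'a::euclidean_space. exp (- (s * norm \<xi> powr \<sigma>)))"
    "\<And>s. s > 0 \<Longrightarrow> (LINT \<xi>::'a|lborel. exp (- (s * norm \<xi> powr \<sigma>))) \<le> K * s powr (- (real DIM('a) / \<sigma>))"
proof -
  define n where "n = DIM('a)"
  define D where "D = real n / \<sigma>"
  define \<omega> where "\<omega> = unit_ball_vol (real n)"
  define T where "T = (\<Sum>k. exp (- real k) * (real k + 1) powr D)"
  have \<omega>: "\<omega> > 0" by (simp add: \<omega>_def)
  have sm: "summable (\<lambda>k. exp (- real k) * (real k + 1) powr D)" by (rule summable_exp_neg_mult_powr)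
  have T: "T > 0" unfolding T_def by (rule suminf_pos[OF sm]) simp
  define R where "R s k = ((real k + 1) / s) powr (1 / \<sigma>)" for s k
  have bound: "(\<integral>\<^sup>+\<xi>. ennreal (exp (- (s * norm \<xi> powr \<sigma>))) \<partial>(lborel :: 'a measure)) \<le> ennreal (\<omega> * T * s powr (- D))"
    if s: "s > 0" for s
  proof -
    have [measurable]: "cball (0::'a) (R s k) \<in> sets borel" for k by simp
    have pt: "ennreal (exp (- (s * norm \<xi> powr \<sigma>)))
        \<le> (\<Sum>k. ennreal (exp (- real k)) * indicator (cball 0 (R s k)) \<xi>)" for \<xi> :: 'a
    proof -
      define y where "y = s * norm \<xi> powr \<sigma>"
      define k where "k = nat \<lfloor>y\<rfloor>"
      have y: "y \<ge> 0" using s by (simp add: y_def)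
      have k: "real k \<le> y" "y \<le> real k + 1" using y unfolding k_def by linarith+
      have "norm \<xi> = (norm \<xi> powr \<sigma>) powr (1 / \<sigma>)" using \<sigma> by (simp add: powr_powr)
      also have "\<dots> \<le> R s k" unfolding R_def
        using k(2) s \<sigma> by (intro powr_mono2) (auto simp: y_def field_simps)
      finally have \<xi>: "\<xi> \<in> cball 0 (R s k)" by simp
      have "ennreal (exp (- y)) \<le> ennreal (exp (- real k)) * indicator (cball 0 (R s k)) \<xi>"
        using k(1) \<xi> by (simp add: ennreal_leI)
      also have "\<dots> \<le> (\<Sum>k. ennreal (exp (- real k)) * indicator (cball 0 (R s k)) \<xi>)"
        by (rule term_le_suminf)
      finally show ?thesis by (simp add: y_def)
    qed
    have "(\<integral>\<^sup>+\<xi>. ennreal (exp (- (s * norm \<xi> powr \<sigma>))) \<partial>(lborel :: 'a measure))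
       \<le> (\<integral>\<^sup>+\<xi>. (\<Sum>k. ennreal (exp (- real k)) * indicator (cball 0 (R s k)) \<xi>) \<partial>(lborel :: 'a measure))"
      by (intro nn_integral_mono pt)
    also have "\<dots> = (\<Sum>k. \<integral>\<^sup>+\<xi>. ennreal (exp (- real k)) * indicator (cball 0 (R s k)) \<xi> \<partial>(lborel :: 'a measure))"
      by (rule nn_integral_suminf) measurable
    also have "\<dots> = (\<Sum>k. ennreal (\<omega> * s powr (- D) * (exp (- real k) * (real k + 1) powr D)))"
    proof (intro suminf_cong)
      fix k
      have "R s k ^ n = R s k powr real n"
        using s by (intro powr_realpow[symmetric]) (simp add: R_def)
      also have "\<dots> = ((real k + 1) / s) powr D" by (simp add: R_def powr_powr D_def)
      also have "\<dots> = (real k + 1) powr D * s powr (- D)"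
        using s by (subst powr_divide) (simp_all add: powr_minus divide_inverse)
      finally have Rn: "R s k ^ n = (real k + 1) powr D * s powr (- D)" .
      have "(\<integral>\<^sup>+\<xi>. ennreal (exp (- real k)) * indicator (cball 0 (R s k)) \<xi> \<partial>(lborel :: 'a measure))
          = ennreal (exp (- real k)) * emeasure lborel (cball (0::'a) (R s k))"
        by (simp add: nn_integral_cmult_indicator)
      also have "emeasure lborel (cball (0::'a) (R s k)) = ennreal (\<omega> * R s k ^ n)"
        by (subst emeasure_cball) (auto simp: \<omega>_def n_def R_def)
      finally show "(\<integral>\<^sup>+\<xi>. ennreal (exp (- real k)) * indicator (cball 0 (R s k)) \<xi> \<partial>(lborel :: 'a measure))
          = ennreal (\<omega> * s powr (- D) * (exp (- real k) * (real k + 1) powr D))"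
        using \<omega> by (simp add: Rn mult_ac flip: ennreal_mult')
    qed
    also have "\<dots> = ennreal (\<omega> * s powr (- D) * T)"
      unfolding T_def using \<omega> sm
      by (subst suminf_ennreal2) (auto simp: suminf_mult summable_mult intro!: mult_nonneg_nonneg)
    finally show ?thesis by (simp add: mult_ac)
  qed
  have int: "integrable lborel (\<lambda>\<xi>::'a. exp (- (s * norm \<xi> powr \<sigma>)))" if s: "s > 0" for s
  proof (rule integrableI_bounded)
    show "(\<integral>\<^sup>+\<xi>. ennreal (norm (exp (- (s * norm \<xi> powr \<sigma>)))) \<partial>(lborel :: 'a measure)) < \<infinity>"
      using bound[OF s] by (simp add: le_less_trans[OF _ ennreal_less_top])
  qed measurable
  show thesis
  proof (rule that[of "\<omega> * T"])
    fix s :: real assume s: "s > 0"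
    show "(LINT \<xi>::'a|lborel. exp (- (s * norm \<xi> powr \<sigma>))) \<le> \<omega> * T * s powr (- (real DIM('a) / \<sigma>))"
      using bound[OF s] \<omega> T by (intro integral_real_bounded) (auto simp: D_def n_def intro!: mult_nonneg_nonneg)
  qed (use \<omega> T int in auto)
qed

text \<open>
  The comparison behind the decay estimate at a fixed time: a main term, a remainder \<open>q\<close> on a
  ball, and an error \<open>e\<close> away from the origin.  The weight \<open>v\<close> enters through its supremum near the
  origin and through its integral far away, which is why the final estimate involves both norms.
\<close>

lemma integral_exp_neg_split:
  fixes \<phi> v :: "'a::euclidean_space \<Rightarrow> real"
  assumes v: "integrable lborel v" "\<And>\<xi>. 0 \<le> v \<xi>" "\<And>\<xi>. v \<xi> \<le> V"
    and [measurable]: "\<phi> \<in> borel_measurable borel"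
    and s: "integrable lborel (\<lambda>\<xi>::'a. exp (- (s * norm \<xi> powr \<sigma>)))"
    and q: "q \<ge> 0" and e: "e \<ge> 0" and R: "R \<ge> 0"
    and near: "\<And>\<xi>. \<xi> \<noteq> 0 \<Longrightarrow> norm \<xi> \<le> r \<Longrightarrow>
        exp (- (t * \<phi> \<xi>)) \<le> exp (- (s * norm \<xi> powr \<sigma>)) + q * indicator (cball 0 R) \<xi>"
    and far: "\<And>\<xi>. norm \<xi> > r \<Longrightarrow> exp (- (t * \<phi> \<xi>)) \<le> e"
  shows "integrable lborel (\<lambda>\<xi>. exp (- (t * \<phi> \<xi>)) * v \<xi>)"
    and "(LINT \<xi>|lborel. exp (- (t * \<phi> \<xi>)) * v \<xi>) \<le>
      V * (LINT \<xi>::'a|lborel. exp (- (s * norm \<xi> powr \<sigma>)))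
      + V * q * (unit_ball_vol (real DIM('a)) * R ^ DIM('a)) + e * (LINT \<xi>|lborel. v \<xi>)"
proof -
  note [measurable] = borel_measurable_integrable[OF v(1)]
  have V: "V \<ge> 0" using v(2,3)[of 0] by linarith
  have iB: "integrable lborel (indicator (cball 0 R) :: 'a \<Rightarrow> real)"
    using emeasure_lborel_cball_finite[of "0::'a" R] by (auto simp: less_top)
  define b where "b \<xi> = V * exp (- (s * norm \<xi> powr \<sigma>)) + V * q * indicator (cball 0 R) \<xi> + e * v \<xi>" for \<xi>
  have ib: "integrable lborel b" unfolding b_def[abs_def] using v(1) s iB by auto
  have le: "AE \<xi> in lborel. exp (- (t * \<phi> \<xi>)) * v \<xi> \<le> b \<xi>"
    using AE_lborel_singleton[of "0::'a"]
  proof eventually_elim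
    case (elim \<xi>)
    show ?case
    proof (cases "norm \<xi> \<le> r")
      case True
      have "exp (- (t * \<phi> \<xi>)) * v \<xi> \<le> (exp (- (s * norm \<xi> powr \<sigma>)) + q * indicator (cball 0 R) \<xi>) * V"
        using near[OF elim True] v by (intro mult_mono) (auto intro!: add_nonneg_nonneg mult_nonneg_nonneg q)
      also have "\<dots> \<le> b \<xi>" using e v(2) by (simp add: b_def algebra_simps)
      finally show ?thesis .
    next
      case False
      have "exp (- (t * \<phi> \<xi>)) * v \<xi> \<le> e * v \<xi>"
        using far False v by (intro mult_right_mono) auto
      also have "\<dots> \<le> b \<xi>" using V q by (simp add: b_def)
      finally show ?thesis .
    qed
  qed
  show i: "integrable lborel (\<lambda>\<xi>. exp (- (t * \<phi> \<xi>)) * v \<xi>)"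
    by (rule Bochner_Integration.integrable_bound[OF ib], measurable, use le in eventually_elim) (use v(2) in \<open>auto simp: abs_mult\<close>)
  have "(LINT \<xi>|lborel. exp (- (t * \<phi> \<xi>)) * v \<xi>) \<le> (LINT \<xi>|lborel. b \<xi>)"
    by (rule integral_mono_AE[OF i ib le])
  also have "\<dots> = V * (LINT \<xi>::'a|lborel. exp (- (s * norm \<xi> powr \<sigma>)))
      + V * q * measure lborel (cball (0::'a) R) + e * (LINT \<xi>|lborel. v \<xi>)"
    unfolding b_def using v(1) s iB by simp
  also have "measure lborel (cball (0::'a) R) = unit_ball_vol (real DIM('a)) * R ^ DIM('a)"
    using R by (simp add: content_cball)
  finally show "(LINT \<xi>|lborel. exp (- (t * \<phi> \<xi>)) * v \<xi>) \<le>
      V * (LINT \<xi>::'a|lborel. exp (- (s * norm \<xi> powr \<sigma>)))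
      + V * q * (unit_ball_vol (real DIM('a)) * R ^ DIM('a)) + e * (LINT \<xi>|lborel. v \<xi>)" .
qed

lemma slowly_varying_pos: "slowly_varying L \<Longrightarrow> s > 0 \<Longrightarrow> L s > 0"
  by (simp add: slowly_varying_def)

text \<open>
  Eventually \<open>L(2s) < 2 L(s)\<close>, so \<open>L\<close> grows at most linearly along dyadic points, and monotonicity
  fills the gaps.  This crude bound suffices because it only has to lose against exponentials.
\<close>

lemma slowly_varying_mono_linear_bound:
  assumes L: "slowly_varying L" and mono: "mono_on {N\<^sub>0..} L"
  obtains B s\<^sub>0 where "B > 0" "s\<^sub>0 > 0" "\<And>s. s \<ge> s\<^sub>0 \<Longrightarrow> L s \<le> B * s"
proof -
  have "((\<lambda>s. L (2 * s) / L s) \<longlongrightarrow> 1) at_top" using L by (simp add: slowly_varying_def)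
  then have "eventually (\<lambda>s. L (2 * s) / L s < 2) at_top" by (rule order_tendstoD) simp
  then obtain s\<^sub>1 where s1: "\<And>s. s \<ge> s\<^sub>1 \<Longrightarrow> L (2 * s) / L s < 2" by (auto simp: eventually_at_top_linorder)
  define s\<^sub>0 where "s\<^sub>0 = max 1 (max s\<^sub>1 N\<^sub>0)"
  have s0: "s\<^sub>0 \<ge> 1" "s\<^sub>0 \<ge> s\<^sub>1" "s\<^sub>0 \<ge> N\<^sub>0" by (auto simp: s\<^sub>0_def)
  have ge: "2 ^ k * s\<^sub>0 \<ge> s\<^sub>0" for k :: nat using s0(1) by simp
  have dyadic: "L (2 ^ k * s\<^sub>0) \<le> 2 ^ k * L s\<^sub>0" for k :: nat
  proof (induction k)
    case (Suc k)
    have "L (2 * (2 ^ k * s\<^sub>0)) / L (2 ^ k * s\<^sub>0) < 2" using s1 ge[of k] s0 by (meson order_trans)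
    moreover have "L (2 ^ k * s\<^sub>0) > 0" using slowly_varying_pos[OF L] s0(1) by simp
    ultimately have "L (2 * (2 ^ k * s\<^sub>0)) < 2 * L (2 ^ k * s\<^sub>0)" by (simp add: divide_less_eq)
    then show ?case using Suc.IH by (simp add: mult_ac)
  qed simp
  have Lp: "L s\<^sub>0 > 0" using slowly_varying_pos[OF L] s0(1) by simp
  show thesis
  proof (rule that[of "2 * L s\<^sub>0" s\<^sub>0])
    fix s assume s: "s \<ge> s\<^sub>0"
    have "\<exists>k::nat. s \<le> 2 ^ k * s\<^sub>0"
    proof -
      obtain k where "s < 2 ^ k" using real_arch_pow[of 2 s] by auto
      then have "s \<le> 2 ^ k * s\<^sub>0" using s0(1) by (smt (verit) mult_le_cancel_left1 zero_less_power)
      then show ?thesis ..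
    qed
    define k where "k = (LEAST k::nat. s \<le> 2 ^ k * s\<^sub>0)"
    have k: "s \<le> 2 ^ k * s\<^sub>0" unfolding k_def using \<open>\<exists>k. _\<close> by (rule LeastI_ex)
    have k2: "2 ^ k \<le> 2 * s"
    proof (cases k)
      case 0
      then show ?thesis using s s0(1) by simp
    next
      case (Suc j)
      then have "\<not> s \<le> 2 ^ j * s\<^sub>0" using not_less_Least[of j "\<lambda>k. s \<le> 2 ^ k * s\<^sub>0"] by (simp add: k_def)
      moreover have "2 ^ j * s\<^sub>0 \<ge> 2 ^ j * 1" using s0(1) by (intro mult_left_mono) auto
      ultimately have "2 ^ j \<le> s" by linarith
      then show ?thesis using Suc by simp
    qed
    have "L s \<le> L (2 ^ k * s\<^sub>0)"
      by (rule mono_onD[OF mono]) (use s s0 k in auto)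
    also have "\<dots> \<le> 2 ^ k * L s\<^sub>0" by (rule dyadic)
    also have "\<dots> \<le> 2 * s * L s\<^sub>0" using k2 Lp by (intro mult_right_mono) auto
    finally show "L s \<le> 2 * L s\<^sub>0 * s" by (simp add: mult_ac)
  qed (use Lp s0 in auto)
qed

lemma eventually_exp_neg_powr_le:
  fixes c \<kappa> B D :: real
  assumes "c > 0" "\<kappa> > 0" "B > 0"
  shows "eventually (\<lambda>t. exp (- (c * t powr \<kappa>)) \<le> (B * t\<^sup>2) powr (- D)) at_top"
proof -
  have "((\<lambda>t. exp (- (c * t powr \<kappa>)) * (B * t\<^sup>2) powr D) \<longlongrightarrow> 0) at_top"
    using assms by real_asymp
  then have "eventually (\<lambda>t. exp (- (c * t powr \<kappa>)) * (B * t\<^sup>2) powr D < 1) at_top"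
    by (rule order_tendstoD) simp
  then show ?thesis using eventually_gt_at_top[of 0]
  proof eventually_elim
    case (elim t)
    then have "(B * t\<^sup>2) powr D > 0" using assms by simp
    then show ?case using elim by (simp add: powr_minus field_simps)
  qed
qed


text \<open>
  With \<open>y = |\<xi>| powr (-\<gamma>)\<close>, the first term on the right dominates when \<open>L y \<ge> L t\<close>, which
  monotonicity provides on one side of \<open>y = t\<close>.  On the other side an increasing \<open>L\<close> is still bounded
  below by \<open>L N\<^sub>0\<close>, and a decreasing one is left with a small ball.
\<close>

lemma regular_variation_decay_pointwise:
  fixes \<phi> :: "'a::euclidean_space \<Rightarrow> real"
  assumes pos: "\<And>s. s > 0 \<Longrightarrow> L s > 0" and "N\<^sub>0 > 0" "\<sigma> > 0" "\<gamma> > 0" "a > 0" "r > 0" and r: "r powr (- \<gamma>) \<ge> N\<^sub>0"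
    and near: "\<And>\<xi>. \<xi> \<noteq> 0 \<Longrightarrow> norm \<xi> \<le> r \<Longrightarrow> a * norm \<xi> powr \<sigma> * L (norm \<xi> powr (- \<gamma>)) \<le> \<phi> \<xi>"
    and t: "t \<ge> N\<^sub>0"
    and \<xi>: "\<xi> \<noteq> 0" "norm \<xi> \<le> r"
  shows "mono_on {N\<^sub>0..} L \<Longrightarrow> \<gamma> > \<sigma> \<Longrightarrow> exp (- (t * \<phi> \<xi>)) \<le> exp (- (a * (t * L t) * norm \<xi> powr \<sigma>))
            + exp (- (a * L N\<^sub>0 * t powr (1 - \<sigma> / \<gamma>))) * indicator (cball 0 r) \<xi>"
    and "antimono_on {N\<^sub>0..} L \<Longrightarrow> \<gamma> = \<sigma> \<Longrightarrow> exp (- (t * \<phi> \<xi>)) \<le> exp (- (a * (t * L t) * norm \<xi> powr \<sigma>))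
            + 1 * indicator (cball 0 (t powr (- (1 / \<sigma>)))) \<xi>"
proof -
  define \<rho> where "\<rho> = norm \<xi>"
  define y where "y = \<rho> powr (- \<gamma>)"
  have \<rho>: "\<rho> > 0" "\<rho> \<le> r" using \<xi> by (auto simp: \<rho>_def)
  have t0: "t > 0" using t assms by linarith
  have "r powr (- \<gamma>) \<le> y" unfolding y_def using \<rho> assms by (intro powr_mono2') auto
  then have yN: "y \<ge> N\<^sub>0" using r by linarith
  have \<rho>y: "\<rho> = y powr (- (1 / \<gamma>))" using \<rho> assms by (simp add: y_def powr_powr)
  have y0: "y > 0" using yN assms by linarith
  have \<phi>: "a * \<rho> powr \<sigma> * L y \<le> \<phi> \<xi>" using near[OF \<xi>] by (simp add: \<rho>_def y_def)
  have main: "exp (- (t * \<phi> \<xi>)) \<le> exp (- (a * (t * L t) * norm \<xi> powr \<sigma>))" if "L t \<le> L y"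
  proof -
    have "a * (t * L t) * \<rho> powr \<sigma> \<le> t * (a * \<rho> powr \<sigma> * L y)"
      using that \<open>a > 0\<close> t0 by (auto simp: mult_ac intro!: mult_left_mono mult_right_mono)
    also have "\<dots> \<le> t * \<phi> \<xi>" using \<phi> t0 by (intro mult_left_mono) auto
    finally show ?thesis by (simp add: \<rho>_def)
  qed
  show "exp (- (t * \<phi> \<xi>)) \<le> exp (- (a * (t * L t) * norm \<xi> powr \<sigma>))
            + exp (- (a * L N\<^sub>0 * t powr (1 - \<sigma> / \<gamma>))) * indicator (cball 0 r) \<xi>"
    if mono: "mono_on {N\<^sub>0..} L" and \<gamma>\<sigma>: "\<gamma> > \<sigma>"
  proof (cases "t \<le> y")
    case True
    then have "L t \<le> L y" using mono_onD[OF mono, of t y] t yN by simp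
    then show ?thesis using main by (simp add: add_increasing2)
  next
    case False
    have "t powr (- (1 / \<gamma>)) \<le> \<rho>" unfolding \<rho>y using False y0 assms by (intro powr_mono2') auto
    then have "(t powr (- (1 / \<gamma>))) powr \<sigma> \<le> \<rho> powr \<sigma>" using assms by (intro powr_mono2) auto
    then have "t powr (- (\<sigma> / \<gamma>)) \<le> \<rho> powr \<sigma>" by (simp add: powr_powr)
    moreover have "L N\<^sub>0 \<le> L y" using mono_onD[OF mono, of "N\<^sub>0" y] yN by simp
    moreover have "L N\<^sub>0 \<ge> 0" using pos[OF \<open>N\<^sub>0 > 0\<close>] by simp
    ultimately have "t * (a * t powr (- (\<sigma> / \<gamma>)) * L N\<^sub>0) \<le> t * (a * \<rho> powr \<sigma> * L y)"
      using t0 \<open>a > 0\<close> by (intro mult_left_mono mult_mono) auto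
    also have "\<dots> \<le> t * \<phi> \<xi>" using \<phi> t0 by (intro mult_left_mono) auto
    also have "t * (a * t powr (- (\<sigma> / \<gamma>)) * L N\<^sub>0) = a * L N\<^sub>0 * t powr (1 - \<sigma> / \<gamma>)"
      using t0 by (simp add: powr_diff powr_minus divide_inverse mult_ac)
    finally show ?thesis using \<xi>(2) by (simp add: add_increasing)
  qed
  show "exp (- (t * \<phi> \<xi>)) \<le> exp (- (a * (t * L t) * norm \<xi> powr \<sigma>))
            + 1 * indicator (cball 0 (t powr (- (1 / \<sigma>)))) \<xi>"
    if anti: "antimono_on {N\<^sub>0..} L" and \<gamma>\<sigma>: "\<gamma> = \<sigma>"
  proof (cases "y \<le> t")
    case True
    then have "L t \<le> L y" using monotone_onD[OF anti, of y t] t yN by simp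
    then show ?thesis using main by (simp add: add_increasing2)
  next
    case False
    then have "\<rho> \<le> t powr (- (1 / \<gamma>))" unfolding \<rho>y using t0 assms by (intro powr_mono2') auto
    then have "\<xi> \<in> cball 0 (t powr (- (1 / \<sigma>)))" by (simp add: \<rho>_def \<gamma>\<sigma>)
    moreover have "0 \<le> a * \<rho> powr \<sigma> * L y" using pos[OF y0] assms by simp
    then have "exp (- (t * \<phi> \<xi>)) \<le> 1" using \<phi> t0 by simp
    ultimately show ?thesis by (simp add: add_increasing)
  qed
qed

text \<open>
  The time \<open>t\<^sub>0\<close> and the constant \<open>C\<close> are chosen before the weight \<open>v\<close>, so the estimate is
  uniform in the initial value that \<open>v\<close> will come from.
\<close>

theorem integral_exp_neg_regular_variation:
  fixes \<phi> :: "'a::euclidean_space \<Rightarrow> real"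
  assumes L: "slowly_varying L" and N0: "N\<^sub>0 > 0" and \<sigma>: "\<sigma> > 0" and \<gamma>: "\<gamma> > 0" and a: "a > 0"
    and r: "r > 0" "r powr (- \<gamma>) \<ge> N\<^sub>0" and \<delta>: "\<delta> > 0"
    and cases: "mono_on {N\<^sub>0..} L \<and> \<gamma> > \<sigma> \<or> antimono_on {N\<^sub>0..} L \<and> \<gamma> = \<sigma>"
    and [measurable]: "\<phi> \<in> borel_measurable borel"
    and near: "\<And>\<xi>. \<xi> \<noteq> 0 \<Longrightarrow> norm \<xi> \<le> r \<Longrightarrow> a * norm \<xi> powr \<sigma> * L (norm \<xi> powr (- \<gamma>)) \<le> \<phi> \<xi>"
    and far: "\<And>\<xi>. norm \<xi> \<ge> r \<Longrightarrow> \<delta> \<le> \<phi> \<xi>"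
  obtains C t\<^sub>0 where "C > 0" "t\<^sub>0 > 0"
    "\<And>(t::real) (v::'a \<Rightarrow> real) (V::real). t \<ge> t\<^sub>0 \<Longrightarrow> integrable lborel v \<Longrightarrow> (\<And>\<xi>. 0 \<le> v \<xi>) \<Longrightarrow> (\<And>\<xi>. v \<xi> \<le> V) \<Longrightarrow>
       (LINT \<xi>|lborel. exp (- (t * \<phi> \<xi>)) * v \<xi>)
       \<le> C * (V + (LINT \<xi>|lborel. v \<xi>)) * (t * L t) powr (- (real DIM('a) / \<sigma>))"
proof -
  note pos = slowly_varying_pos[OF L]
  define D where "D = real DIM('a) / \<sigma>"
  have D: "D > 0" using \<sigma> by (simp add: D_def)
  define \<omega> where "\<omega> = unit_ball_vol (real DIM('a))"
  have \<omega>: "\<omega> > 0" by (simp add: \<omega>_def)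
  obtain B s\<^sub>0 where B: "B > 0" "\<And>s. s \<ge> s\<^sub>0 \<Longrightarrow> L s \<le> B * s" "s\<^sub>0 > 0"
    using cases
  proof
    assume "mono_on {N\<^sub>0..} L \<and> \<gamma> > \<sigma>"
    then show thesis using slowly_varying_mono_linear_bound[OF L] that by metis
  next
    assume anti: "antimono_on {N\<^sub>0..} L \<and> \<gamma> = \<sigma>"
    show thesis
    proof (rule that[of "L N\<^sub>0" "max 1 N\<^sub>0"])
      fix s assume s: "s \<ge> max 1 N\<^sub>0"
      have "L s \<le> L N\<^sub>0 * 1" using anti s by (auto dest: monotone_onD[of _ _ _ _ "N\<^sub>0" s])
      also have "\<dots> \<le> L N\<^sub>0 * s" using s pos[OF N0] by (intro mult_left_mono) auto
      finally show "L s \<le> L N\<^sub>0 * s" .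
    qed (use pos[OF N0] in auto)
  qed
  have poly: "(B * t\<^sup>2) powr (- D) \<le> (t * L t) powr (- D)" if "t \<ge> s\<^sub>0" for t
  proof (rule powr_mono2')
    have "t * L t \<le> t * (B * t)" using B that by (intro mult_left_mono) auto
    then show "t * L t \<le> B * t\<^sup>2" by (simp add: power2_eq_square mult_ac)
    show "0 < t * L t" using pos[of t] B(3) that by simp
  qed (use D in auto)
  have exps: "eventually (\<lambda>t. exp (- (c * t powr \<kappa>)) \<le> (t * L t) powr (- D)) at_top" if "c > 0" "\<kappa> > 0" for c \<kappa>
    using eventually_exp_neg_powr_le[OF that B(1), of D] eventually_ge_at_top[of s\<^sub>0]
    by eventually_elim (use poly in force)
  obtain K where K: "K > 0"
    "\<And>s. s > 0 \<Longrightarrow> integrable lborel (\<lambda>\<xi>::'a. exp (- (s * norm \<xi> powr \<sigma>)))"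
    "\<And>s. s > 0 \<Longrightarrow> (LINT \<xi>::'a|lborel. exp (- (s * norm \<xi> powr \<sigma>))) \<le> K * s powr (- D)"
    using integral_exp_neg_norm_powr_le[OF \<sigma>, where 'a='a] unfolding D_def by metis
  \<comment> \<open>\<open>q\<close> and \<open>R\<close> describe the remainder near the origin in the two monotone cases: an exponentially
    small constant on a fixed ball, or the constant 1 on a shrinking ball.\<close>
  obtain q R C\<^sub>2 where q: "\<And>t. q t \<ge> 0" "\<And>t. R t \<ge> 0" "C\<^sub>2 > 0"
    and near': "\<And>t \<xi>. t \<ge> N\<^sub>0 \<Longrightarrow> \<xi> \<noteq> 0 \<Longrightarrow> norm \<xi> \<le> r \<Longrightarrow>
        exp (- (t * \<phi> \<xi>)) \<le> exp (- (a * (t * L t) * norm \<xi> powr \<sigma>)) + q t * indicator (cball 0 (R t)) \<xi>"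
    and qR: "eventually (\<lambda>t. q t * (\<omega> * R t ^ DIM('a)) \<le> C\<^sub>2 * (t * L t) powr (- D)) at_top"
    using cases
  proof
    assume c: "mono_on {N\<^sub>0..} L \<and> \<gamma> > \<sigma>"
    show thesis
    proof (rule that[of "\<lambda>t. exp (- (a * L N\<^sub>0 * t powr (1 - \<sigma> / \<gamma>)))" "\<lambda>_. r" "\<omega> * r ^ DIM('a)"])
      have "eventually (\<lambda>t. exp (- (a * L N\<^sub>0 * t powr (1 - \<sigma> / \<gamma>))) \<le> (t * L t) powr (- D)) at_top"
        using c \<gamma> a pos[OF N0] by (intro exps) auto
      then show "eventually (\<lambda>t. exp (- (a * L N\<^sub>0 * t powr (1 - \<sigma> / \<gamma>))) * (\<omega> * r ^ DIM('a))
          \<le> \<omega> * r ^ DIM('a) * (t * L t) powr (- D)) at_top"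
        by eventually_elim (use \<omega> r in \<open>simp add: mult.commute\<close>)
    next
      fix t and \<xi> :: 'a assume h: "t \<ge> N\<^sub>0" "\<xi> \<noteq> 0" "norm \<xi> \<le> r"
      show "exp (- (t * \<phi> \<xi>)) \<le> exp (- (a * (t * L t) * norm \<xi> powr \<sigma>))
         + exp (- (a * L N\<^sub>0 * t powr (1 - \<sigma> / \<gamma>))) * indicator (cball 0 r) \<xi>"
        by (rule regular_variation_decay_pointwise(1)[OF pos N0 \<sigma> \<gamma> a r near h]) (use c in auto)
    qed (use r \<omega> in auto)
  next
    assume c: "antimono_on {N\<^sub>0..} L \<and> \<gamma> = \<sigma>"
    show thesis
    proof (rule that[of "\<lambda>_. 1" "\<lambda>t. t powr (- (1 / \<sigma>))" "\<omega> * L N\<^sub>0 powr D"])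
      show "eventually (\<lambda>t. 1 * (\<omega> * (t powr (- (1 / \<sigma>))) ^ DIM('a))
          \<le> \<omega> * L N\<^sub>0 powr D * (t * L t) powr (- D)) at_top"
        using eventually_ge_at_top[of "N\<^sub>0"]
      proof eventually_elim
        case (elim t)
        have t: "t > 0" using elim N0 by linarith
        have "(t powr (- (1 / \<sigma>))) ^ DIM('a) = t powr (- D)"
          using t by (subst powr_realpow[symmetric]) (auto simp: powr_powr D_def)
        also have "\<dots> = L N\<^sub>0 powr D * (t * L N\<^sub>0) powr (- D)"
          using t pos[OF N0] by (simp add: powr_mult powr_minus field_simps)
        also have "\<dots> \<le> L N\<^sub>0 powr D * (t * L t) powr (- D)"
        proof (intro mult_left_mono powr_mono2')
          show "L t \<le> L N\<^sub>0" using c elim by (auto dest: monotone_onD[of _ _ _ _ "N\<^sub>0" t])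
        qed (use t pos[of t] pos[OF N0] D in auto)
        finally show ?case using \<omega> by (simp add: mult_ac mult_left_mono)
      qed
    next
      fix t and \<xi> :: 'a assume h: "t \<ge> N\<^sub>0" "\<xi> \<noteq> 0" "norm \<xi> \<le> r"
      show "exp (- (t * \<phi> \<xi>)) \<le> exp (- (a * (t * L t) * norm \<xi> powr \<sigma>))
         + 1 * indicator (cball 0 (t powr (- (1 / \<sigma>)))) \<xi>"
        by (rule regular_variation_decay_pointwise(2)[OF pos N0 \<sigma> \<gamma> a r near h]) (use c in auto)
    qed (use \<omega> pos[OF N0] in auto)
  qed
  have "eventually (\<lambda>t. exp (- (\<delta> * t powr 1)) \<le> (t * L t) powr (- D)) at_top" by (rule exps) (use \<delta> in auto)
  then have "eventually (\<lambda>t. t \<ge> N\<^sub>0 \<and> q t * (\<omega> * R t ^ DIM('a)) \<le> C\<^sub>2 * (t * L t) powr (- D)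
     \<and> exp (- (\<delta> * t)) \<le> (t * L t) powr (- D)) at_top"
    using qR eventually_ge_at_top[of "N\<^sub>0"]
  proof eventually_elim
    case (elim t)
    moreover have "t powr 1 = t" using elim N0 by simp
    ultimately show ?case by metis
  qed
  then obtain t\<^sub>1 where t1: "\<And>t. t \<ge> t\<^sub>1 \<Longrightarrow> t \<ge> N\<^sub>0 \<and> q t * (\<omega> * R t ^ DIM('a)) \<le> C\<^sub>2 * (t * L t) powr (- D)
     \<and> exp (- (\<delta> * t)) \<le> (t * L t) powr (- D)" by (auto simp: eventually_at_top_linorder)
  define C where "C = K * a powr (- D) + C\<^sub>2 + 1"
  have C: "C > 0" using K q a by (simp add: C_def add_pos_pos)
  show thesis
  proof (rule that[OF C, of "max 1 t\<^sub>1"])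
    fix t V :: real and v :: "'a \<Rightarrow> real" assume t: "t \<ge> max 1 t\<^sub>1" and v: "integrable lborel v" "\<And>\<xi>::'a. 0 \<le> v \<xi>" "\<And>\<xi>. v \<xi> \<le> V"
    define X where "X = (t * L t) powr (- D)"
    have tN: "t \<ge> N\<^sub>0" and qX: "q t * (\<omega> * R t ^ DIM('a)) \<le> C\<^sub>2 * X" and eX: "exp (- (\<delta> * t)) \<le> X"
      using t1[of t] t by (auto simp: X_def)
    have V: "V \<ge> 0" using v(2,3)[of 0] by linarith
    have W: "(LINT \<xi>|lborel. v \<xi>) \<ge> 0" using v by simp
    have tL: "t * L t > 0" using t pos[of t] by simp
    have X: "X \<ge> 0" by (simp add: X_def)
    have "(LINT \<xi>|lborel. exp (- (t * \<phi> \<xi>)) * v \<xi>) \<le>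
      V * (LINT \<xi>::'a|lborel. exp (- (a * (t * L t) * norm \<xi> powr \<sigma>)))
      + V * q t * (\<omega> * R t ^ DIM('a)) + exp (- (\<delta> * t)) * (LINT \<xi>|lborel. v \<xi>)"
      unfolding \<omega>_def
    proof (rule integral_exp_neg_split(2)[OF v])
      show "exp (- (t * \<phi> \<xi>)) \<le> exp (- (\<delta> * t))" if "norm \<xi> > r" for \<xi>
        using far[of \<xi>] that t by (simp add: mult.commute)
    qed (use near' tN q K a tL in auto)
    also have "\<dots> \<le> V * (K * (a powr (- D) * X)) + V * (C\<^sub>2 * X) + X * (LINT \<xi>|lborel. v \<xi>)"
    proof (intro add_mono)
      have "(LINT \<xi>::'a|lborel. exp (- (a * (t * L t) * norm \<xi> powr \<sigma>))) \<le> K * (a * (t * L t)) powr (- D)"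
        using K(3)[of "a * (t * L t)"] a tL by simp
      also have "\<dots> = K * (a powr (- D) * X)" using a tL by (simp add: X_def powr_mult)
      finally show "V * (LINT \<xi>::'a|lborel. exp (- (a * (t * L t) * norm \<xi> powr \<sigma>))) \<le> V * (K * (a powr (- D) * X))"
        using V by (rule mult_left_mono)
      show "V * q t * (\<omega> * R t ^ DIM('a)) \<le> V * (C\<^sub>2 * X)"
        using mult_left_mono[OF qX V] by (simp add: mult.assoc)
      show "exp (- (\<delta> * t)) * (LINT \<xi>|lborel. v \<xi>) \<le> X * (LINT \<xi>|lborel. v \<xi>)"
        using eX W by (rule mult_right_mono)
    qed
    also have "\<dots> \<le> C * (V + (LINT \<xi>|lborel. v \<xi>)) * X"
    proof -
      have "0 \<le> V * X" "0 \<le> (LINT \<xi>|lborel. v \<xi>) * X * (K * a powr (- D))" "0 \<le> (LINT \<xi>|lborel. v \<xi>) * X * C\<^sub>2"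
        using V W X K q by (auto intro!: mult_nonneg_nonneg)
      then show ?thesis by (simp add: C_def algebra_simps)
    qed
    finally show "(LINT \<xi>|lborel. exp (- (t * \<phi> \<xi>)) * v \<xi>)
       \<le> C * (V + (LINT \<xi>|lborel. v \<xi>)) * (t * L t) powr (- (real DIM('a) / \<sigma>))"
      by (simp add: X_def D_def)
  qed simp
qed

section \<open>Interpolation, iterates and Poisson averages\<close>

text \<open>
  For finite \<open>p\<close> this is \<open>|f|\<^sup>p \<le> (C S) powr (p - 1) |f|\<close>.  The bounds are proportional to a common
  \<open>S\<close>, which may vanish, so that the result is linear in \<open>S\<close>.
\<close>

lemma Lp_interpolation_1_infinity:
  fixes f :: "'a::euclidean_space \<Rightarrow> 'b::{banach,second_countable_topology}"
  assumes f: "integrable lebesgue f" and p: "1 < p" and C: "C > 0"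
    and bound: "AE x in lebesgue. norm (f x) \<le> C * S" and L1: "(LINT x|lebesgue. norm (f x)) \<le> S"
  shows "f \<in> Lp_space p" and "Lp_norm p f \<le> C powr (1 - enn2real (1 / p)) * S"
proof -
  note [measurable] = borel_measurable_integrable[OF f]
  have S: "S \<ge> 0" using L1 order_trans[OF integral_nonneg_AE L1] by auto
  have "f \<in> Lp_space p \<and> Lp_norm p f \<le> C powr (1 - enn2real (1 / p)) * S"
  proof (cases "p = \<infinity>")
    case True
    have "AE x in lebesgue. ennreal (norm (f x)) \<le> ennreal (C * S)"
      using bound by eventually_elim (simp add: ennreal_leI)
    then have le: "esssup lebesgue (\<lambda>x. ennreal (norm (f x))) \<le> ennreal (C * S)"
      by (intro esssup_I) measurable
    then have "enn2real (esssup lebesgue (\<lambda>x. ennreal (norm (f x)))) \<le> C * S"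
      using C S by (intro enn2real_leI) auto
    moreover have "esssup lebesgue (\<lambda>x. ennreal (norm (f x))) < \<infinity>"
      using le by (rule le_less_trans) simp
    ultimately show ?thesis using True C by (simp add: Lp_space_def Lp_norm_def)
  next
    case False
    define q where "q = enn2real p"
    have pq: "p = ennreal q" using False by (simp add: q_def less_top)
    have q: "q > 1" using p unfolding pq ennreal_1[symmetric] by (simp add: ennreal_less_iff)
    have \<theta>: "enn2real (1 / p) = 1 / q"
      using q divide_ennreal[of 1 q] by (simp add: pq)
    define M where "M = (C * S) powr (q - 1)"
    have pt: "AE x in lebesgue. norm (f x) powr q \<le> M * norm (f x)"
      using bound
    proof eventually_elim
      case (elim x)
      have "norm (f x) powr q = norm (f x) * norm (f x) powr (q - 1)"
        by (subst powr_mult_base) auto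
      also have "\<dots> \<le> norm (f x) * M"
        unfolding M_def using elim q by (intro mult_left_mono powr_mono2) auto
      finally show ?case by (simp add: mult.commute)
    qed
    have iM: "integrable lebesgue (\<lambda>x. M * norm (f x))" using f by auto
    have i: "integrable lebesgue (\<lambda>x. norm (f x) powr q)"
      by (rule Bochner_Integration.integrable_bound[OF iM], measurable, use pt in eventually_elim) auto
    have "(LINT x|lebesgue. norm (f x) powr q) \<le> (LINT x|lebesgue. M * norm (f x))"
      by (rule integral_mono_AE[OF i iM pt])
    also have "\<dots> \<le> M * S" using L1 by (auto simp: M_def intro!: mult_left_mono)
    finally have "(LINT x|lebesgue. norm (f x) powr q) powr (1 / q) \<le> (M * S) powr (1 / q)"
      using q by (intro powr_mono2) auto
    also have "(M * S) powr (1 / q) = C powr (1 - 1 / q) * S"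
    proof (cases "S = 0")
      case False
      then have S0: "S > 0" using S by simp
      have "M * S = C powr (q - 1) * S powr q"
        using S0 C powr_mult_base[of S "q - 1"] by (simp add: M_def powr_mult mult_ac)
      then have "(M * S) powr (1 / q) = C powr ((q - 1) / q) * S"
        using S0 C q by (simp add: powr_mult powr_powr)
      also have "(q - 1) / q = 1 - 1 / q" using q by (simp add: field_simps)
      finally show ?thesis .
    qed simp
    finally show ?thesis
      using i pq q \<theta> by (auto simp: Lp_space_def Lp_norm_def)
  qed
  then show "f \<in> Lp_space p" and "Lp_norm p f \<le> C powr (1 - enn2real (1 / p)) * S" by auto
qed

context
  fixes J :: "'a::euclidean_space \<Rightarrow> real"
  assumes J: "integrable lborel J" and J1: "(LINT x|lborel. norm (J x)) = 1"
begin

lemma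
  assumes u: "integrable lborel u"
  shows integrable_conv_op_funpow: "integrable lborel ((conv_op J ^^ k) u)"
    and integral_norm_conv_op_funpow_le: "(LINT x|lborel. norm ((conv_op J ^^ k) u x)) \<le> (LINT x|lborel. norm (u x))"
    and fourier_conv_op_funpow: "fourier ((conv_op J ^^ k) u) \<xi> = fourier (\<lambda>x. complex_of_real (J x)) \<xi> ^ k * fourier u \<xi>"
proof -
  have "integrable lborel ((conv_op J ^^ k) u) \<and> (LINT x|lborel. norm ((conv_op J ^^ k) u x)) \<le> (LINT x|lborel. norm (u x))
     \<and> fourier ((conv_op J ^^ k) u) \<xi> = fourier (\<lambda>x. complex_of_real (J x)) \<xi> ^ k * fourier u \<xi>"
  proof (induction k)
    case (Suc k)
    then have i: "integrable lborel ((conv_op J ^^ k) u)" by simp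
    show ?case
      using Suc.IH integrable_conv_op[OF J i] integral_norm_conv_op_le[OF J i] fourier_conv_op[OF J i, of \<xi>] J1
      by (auto simp: mult_ac)
  qed (use u in simp)
  then show "integrable lborel ((conv_op J ^^ k) u)" "(LINT x|lborel. norm ((conv_op J ^^ k) u x)) \<le> (LINT x|lborel. norm (u x))"
    "fourier ((conv_op J ^^ k) u) \<xi> = fourier (\<lambda>x. complex_of_real (J x)) \<xi> ^ k * fourier u \<xi>" by auto
qed

lemma norm_fourier_le_1: "norm (fourier (\<lambda>x. complex_of_real (J x)) \<xi>) \<le> 1"
  using norm_fourier_le[of "\<lambda>x. complex_of_real (J x)" \<xi>] J J1 by simp

lemma integrable_norm_fourier_pow:
  assumes u: "integrable lborel u" and fu: "integrable lborel (fourier u)"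
  shows "integrable lborel (\<lambda>\<xi>. norm (fourier (\<lambda>x. complex_of_real (J x)) \<xi>) ^ k * norm (fourier u \<xi>))"
proof -
  have [measurable]: "fourier (\<lambda>x. complex_of_real (J x)) \<in> borel_measurable borel" "fourier u \<in> borel_measurable borel"
    using J u by (auto intro!: borel_measurable_fourier)
  show ?thesis
  proof (rule Bochner_Integration.integrable_bound[OF fu])
    show "AE \<xi> in lborel. norm (norm (fourier (\<lambda>x. complex_of_real (J x)) \<xi>) ^ k * norm (fourier u \<xi>)) \<le> norm (fourier u \<xi>)"
      by (auto intro!: AE_I2 mult_left_le_one_le power_le_one norm_fourier_le_1 simp: abs_mult)
  qed measurable
qed

lemma AE_norm_conv_op_funpow_le:
  assumes u: "integrable lborel u" and fu: "integrable lborel (fourier u)"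
  shows "AE x in lborel. norm ((conv_op J ^^ k) u x) \<le>
    (LINT \<xi>|lborel. norm (fourier (\<lambda>x. complex_of_real (J x)) \<xi>) ^ k * norm (fourier u \<xi>)) / (2 * pi) ^ DIM('a)"
proof -
  have m: "fourier ((conv_op J ^^ k) u) \<in> borel_measurable lborel"
    using borel_measurable_fourier[OF integrable_conv_op_funpow[OF u, of k]] by simp
  have n: "norm (fourier ((conv_op J ^^ k) u) \<xi>) = norm (fourier (\<lambda>x. complex_of_real (J x)) \<xi>) ^ k * norm (fourier u \<xi>)" for \<xi>
    by (simp add: fourier_conv_op_funpow[OF u] norm_mult norm_power)
  have "integrable lborel (fourier ((conv_op J ^^ k) u))"
    using integrable_norm_fourier_pow[OF u fu, of k] unfolding n[symmetric] by (simp add: integrable_norm_iff[OF m])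
  from AE_norm_le_fourier_integral[OF integrable_conv_op_funpow[OF u] this] show ?thesis
    by (simp only: n)
qed

end

text \<open>
  The assumption on partial sums makes the series converge absolutely wherever all bounds
  \<open>m k\<close> hold, that is, almost everywhere; it is also the supremum bound itself after multiplication by
  \<open>exp (-t)\<close>.  The \<open>L\<^sup>1\<close> bound follows by integrating term by term.
\<close>

lemma poisson_average:
  fixes f :: "nat \<Rightarrow> 'a::euclidean_space \<Rightarrow> complex"
  assumes f: "\<And>k. integrable lborel (f k)" and L1: "\<And>k. (LINT x|lborel. norm (f k x)) \<le> S"
    and m: "\<And>k. AE x in lborel. norm (f k x) \<le> m k" and t: "t \<ge> 0"
    and M: "\<And>n. (\<Sum>k<n. t ^ k / fact k * m k) \<le> exp t * M"
  defines "u \<equiv> \<lambda>x. complex_of_real (exp (- t)) * (\<Sum>k. complex_of_real (t ^ k / fact k) * f k x)"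
  shows "integrable lborel u" and "(LINT x|lborel. norm (u x)) \<le> S" and "AE x in lborel. norm (u x) \<le> M"
proof -
  note [measurable] = borel_measurable_integrable[OF f]
  have um [measurable]: "u \<in> borel_measurable borel" unfolding u_def by measurable
  have S: "S \<ge> 0" using order_trans[OF integral_nonneg_AE L1[of 0]] by auto
  define g where "g x k = t ^ k / fact k * norm (f k x)" for x k
  have g0: "g x k \<ge> 0" for x k using t by (simp add: g_def)
  have ng: "norm (complex_of_real (t ^ k / fact k) * f k x) = g x k" for k x
    using t by (simp add: g_def norm_mult norm_divide norm_power)
  have "AE x in lborel. \<forall>k. norm (f k x) \<le> m k" using m by (simp add: AE_all_countable)
  then have key: "AE x in lborel. summable (g x) \<and> norm (u x) \<le> exp (- t) * (\<Sum>k. g x k) \<and> (\<Sum>k. g x k) \<le> exp t * M"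
  proof eventually_elim
    case (elim x)
    have le: "(\<Sum>k<n. g x k) \<le> exp t * M" for n
    proof -
      have "(\<Sum>k<n. g x k) \<le> (\<Sum>k<n. t ^ k / fact k * m k)"
        unfolding g_def using elim t by (intro sum_mono mult_left_mono) auto
      then show ?thesis using M[of n] by linarith
    qed
    have s: "summable (g x)" by (rule summableI_nonneg_bounded[OF g0 le])
    have "norm (\<Sum>k. complex_of_real (t ^ k / fact k) * f k x) \<le> (\<Sum>k. norm (complex_of_real (t ^ k / fact k) * f k x))"
      by (rule summable_norm) (use s in \<open>simp only: ng\<close>)
    then have "norm (\<Sum>k. complex_of_real (t ^ k / fact k) * f k x) \<le> (\<Sum>k. g x k)"
      by (simp only: ng)
    then have "exp (- t) * norm (\<Sum>k. complex_of_real (t ^ k / fact k) * f k x) \<le> exp (- t) * (\<Sum>k. g x k)"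
      by (rule mult_left_mono) simp
    then have "norm (u x) \<le> exp (- t) * (\<Sum>k. g x k)"
      by (simp only: u_def norm_mult norm_of_real abs_exp_cancel)
    then show ?case using s suminf_le_const[OF s le] by blast
  qed
  show "AE x in lborel. norm (u x) \<le> M"
    using key
  proof eventually_elim
    case (elim x)
    then have "norm (u x) \<le> exp (- t) * (exp t * M)"
      by (meson exp_ge_zero mult_left_mono order_trans)
    then show ?case by (simp add: mult.assoc[symmetric] exp_add[symmetric])
  qed
  have "(\<integral>\<^sup>+x. ennreal (norm (u x)) \<partial>lborel) \<le> (\<integral>\<^sup>+x. ennreal (exp (- t)) * (\<Sum>k. ennreal (g x k)) \<partial>lborel)"
  proof (rule nn_integral_mono_AE)
    show "AE x in lborel. ennreal (norm (u x)) \<le> ennreal (exp (- t)) * (\<Sum>k. ennreal (g x k))"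
      using key
    proof eventually_elim
      case (elim x)
      then have "ennreal (norm (u x)) \<le> ennreal (exp (- t) * (\<Sum>k. g x k))" by (intro ennreal_leI) auto
      also have "\<dots> = ennreal (exp (- t)) * (\<Sum>k. ennreal (g x k))"
        using elim g0 by (subst suminf_ennreal2) (auto simp: ennreal_mult suminf_nonneg)
      finally show ?case .
    qed
  qed
  also have "\<dots> = ennreal (exp (- t)) * (\<Sum>k. \<integral>\<^sup>+x. ennreal (g x k) \<partial>lborel)"
  proof -
    have gm: "(\<lambda>x. ennreal (g x k)) \<in> borel_measurable lborel" for k unfolding g_def by measurable
    have "(\<integral>\<^sup>+x. ennreal (exp (- t)) * (\<Sum>k. ennreal (g x k)) \<partial>lborel)
        = ennreal (exp (- t)) * (\<integral>\<^sup>+x. (\<Sum>k. ennreal (g x k)) \<partial>lborel)"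
      by (intro nn_integral_cmult borel_measurable_suminf_order gm)
    also have "(\<integral>\<^sup>+x. (\<Sum>k. ennreal (g x k)) \<partial>lborel) = (\<Sum>k. \<integral>\<^sup>+x. ennreal (g x k) \<partial>lborel)"
      by (rule nn_integral_suminf[OF gm])
    finally show ?thesis .
  qed
  also have "\<dots> \<le> ennreal (exp (- t)) * (\<Sum>k. ennreal (t ^ k / fact k * S))"
  proof (intro mult_left_mono suminf_le summableI)
    fix k
    have "(\<integral>\<^sup>+x. ennreal (g x k) \<partial>lborel) = ennreal (LINT x|lborel. g x k)"
      by (rule nn_integral_eq_integral) (use f[of k] g0 in \<open>auto simp: g_def\<close>)
    also have "\<dots> \<le> ennreal (t ^ k / fact k * S)"
      unfolding g_def using L1[of k] t by (intro ennreal_leI) (auto intro!: divide_right_mono mult_left_mono)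
    finally show "(\<integral>\<^sup>+x. ennreal (g x k) \<partial>lborel) \<le> ennreal (t ^ k / fact k * S)" .
  qed simp
  also have "\<dots> = ennreal (exp (- t)) * ennreal (exp t * S)"
  proof -
    have "(\<lambda>k. t ^ k / fact k * S) sums (exp t * S)"
      using sums_mult2[OF exp_converges[of t], of S] by (simp add: divide_inverse mult_ac)
    then show ?thesis using t S by (subst suminf_ennreal2) (auto simp: sums_iff)
  qed
  also have "\<dots> = ennreal S"
    by (subst ennreal_mult[symmetric]) (auto simp: S mult.assoc[symmetric] exp_add[symmetric])
  finally have le: "(\<integral>\<^sup>+x. ennreal (norm (u x)) \<partial>lborel) \<le> ennreal S" .
  show iu: "integrable lborel u"
    by (rule integrableI_bounded) (use le in \<open>auto intro: le_less_trans\<close>)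
  show "(LINT x|lborel. norm (u x)) \<le> S"
    using le S iu by (intro integral_real_bounded) auto
qed

section \<open>Decay of iterates and solutions\<close>

text \<open>
  The modulus of \<open>1 - A g\<close> has to be \<open>1 - A g\<close>, with \<open>g\<close> the profile
  \<open>|\<xi>|\<^sup>\<sigma> L(|\<xi>| powr (-\<gamma>))\<close>.  This needs \<open>A g \<le> 1\<close>, which follows from the expansion itself: the
  transform is continuous with value 1 at the origin and differs from 1 by at least \<open>A g / 2\<close>.
\<close>

lemma symbol_estimates:
  fixes J :: "'a::euclidean_space \<Rightarrow> real"
  assumes J: "integrable lborel J" and J_nonneg: "AE x in lborel. J x \<ge> 0" and J1: "(LINT x|lborel. J x) = 1"
    and L: "slowly_varying L" and N0: "N\<^sub>0 > 0" and A: "A > 0" and \<gamma>: "\<gamma> > 0"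
    and asymp: "(\<lambda>\<xi>. fourier (\<lambda>x. complex_of_real (J x)) \<xi>
            - complex_of_real (1 - A * norm \<xi> powr \<sigma> * L (norm \<xi> powr (- \<gamma>))))
         \<in> o[at 0](\<lambda>\<xi>. complex_of_real (norm \<xi> powr \<sigma> * L (norm \<xi> powr (- \<gamma>))))"
  obtains r \<delta> where "r > 0" "r powr (- \<gamma>) \<ge> N\<^sub>0" "\<delta> > 0"
    "\<And>\<xi>. \<xi> \<noteq> 0 \<Longrightarrow> norm \<xi> \<le> r \<Longrightarrow>
       A / 2 * norm \<xi> powr \<sigma> * L (norm \<xi> powr (- \<gamma>)) \<le> 1 - norm (fourier (\<lambda>x. complex_of_real (J x)) \<xi>)"
    "\<And>\<xi>. norm \<xi> \<ge> r \<Longrightarrow> \<delta> \<le> 1 - norm (fourier (\<lambda>x. complex_of_real (J x)) \<xi>)"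
proof -
  let ?F = "fourier (\<lambda>x. complex_of_real (J x))"
  define g where "g \<xi> = norm \<xi> powr \<sigma> * L (norm \<xi> powr (- \<gamma>))" for \<xi> :: 'a
  have g_nonneg: "g \<xi> \<ge> 0" if "\<xi> \<noteq> 0" for \<xi>
    using slowly_varying_pos[OF L, of "norm \<xi> powr (- \<gamma>)"] that by (simp add: g_def)
  have Jc: "integrable lborel (\<lambda>x. complex_of_real (J x))" using J by auto
  have F0: "?F 0 = 1" using borel_measurable_integrable[OF Jc] J1 by (simp add: fourier_lborel)
  have "(\<lambda>\<xi>. ?F \<xi> - complex_of_real (1 - A * g \<xi>)) \<in> o[at 0](\<lambda>\<xi>. complex_of_real (g \<xi>))"
    using asymp by (simp add: g_def mult.assoc)
  then have "eventually (\<lambda>\<xi>. norm (?F \<xi> - complex_of_real (1 - A * g \<xi>)) \<le> A / 2 * norm (complex_of_real (g \<xi>))) (at 0)"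
    by (rule landau_o.smallD) (use A in simp)
  moreover have "eventually (\<lambda>\<xi>. dist (?F \<xi>) 1 < 1 / 2) (at 0)"
    using isCont_fourier[OF Jc, of 0] F0 tendstoD[of ?F 1 "at 0" "1/2"] by (simp add: isCont_def)
  moreover have "eventually (\<lambda>\<xi>. \<xi> \<noteq> 0) (at (0::'a))" by (simp add: eventually_at_filter)
  ultimately have "eventually (\<lambda>\<xi>. A / 2 * g \<xi> \<le> 1 - norm (?F \<xi>)) (at 0)"
  proof eventually_elim
    case (elim \<xi>)
    have "\<xi> \<noteq> 0" using elim(3) by blast
    then have g: "norm (complex_of_real (g \<xi>)) = g \<xi>" using g_nonneg by simp
    have "A * g \<xi> = norm (complex_of_real (A * g \<xi>))" using A g_nonneg[OF \<open>\<xi> \<noteq> 0\<close>] by (simp add: norm_mult)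
    also have "\<dots> = norm ((?F \<xi> - complex_of_real (1 - A * g \<xi>)) - (?F \<xi> - 1))" by simp
    also have "\<dots> \<le> A / 2 * g \<xi> + 1 / 2"
      using norm_triangle_ineq4[of "?F \<xi> - complex_of_real (1 - A * g \<xi>)" "?F \<xi> - 1"] elim(1,2) g
      by (simp add: dist_norm)
    finally have Ag: "A * g \<xi> \<le> 1" by simp
    have "norm (?F \<xi>) \<le> norm (?F \<xi> - complex_of_real (1 - A * g \<xi>)) + norm (complex_of_real (1 - A * g \<xi>))"
      using norm_triangle_ineq[of "?F \<xi> - complex_of_real (1 - A * g \<xi>)" "complex_of_real (1 - A * g \<xi>)"] by simp
    also have "norm (complex_of_real (1 - A * g \<xi>)) = 1 - A * g \<xi>" using Ag by (subst norm_of_real) simp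
    finally show ?case using elim(1) g by simp
  qed
  then obtain d where d: "d > 0" "\<And>\<xi>. \<xi> \<noteq> 0 \<Longrightarrow> dist \<xi> 0 < d \<Longrightarrow> A / 2 * g \<xi> \<le> 1 - norm (?F \<xi>)"
    unfolding eventually_at by auto
  \<comment> \<open>The second bound puts \<open>|\<xi>| powr (-\<gamma>)\<close> into the range \<open>[N\<^sub>0, \<infinity>)\<close> where \<open>L\<close> is monotone.\<close>
  define r where "r = min (d / 2) (N\<^sub>0 powr (- (1 / \<gamma>)))"
  have r: "r > 0" using d N0 by (simp add: r_def)
  have "(N\<^sub>0 powr (- (1 / \<gamma>))) powr (- \<gamma>) \<le> r powr (- \<gamma>)"
    using r \<gamma> by (intro powr_mono2') (auto simp: r_def)
  then have rN: "r powr (- \<gamma>) \<ge> N\<^sub>0" using N0 \<gamma> by (simp add: powr_powr)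
  obtain \<delta> where \<delta>: "\<delta> > 0" "\<And>\<xi>. norm \<xi> \<ge> r \<Longrightarrow> norm (?F \<xi>) \<le> 1 - \<delta>"
    using fourier_density_gap[OF J J_nonneg J1 r] by metis
  show thesis
  proof (rule that[OF r rN \<delta>(1)])
    fix \<xi> :: 'a assume "\<xi> \<noteq> 0" "norm \<xi> \<le> r"
    then have "A / 2 * g \<xi> \<le> 1 - norm (?F \<xi>)" using d(1) by (intro d(2)) (auto simp: r_def)
    then show "A / 2 * norm \<xi> powr \<sigma> * L (norm \<xi> powr (- \<gamma>)) \<le> 1 - norm (?F \<xi>)"
      by (simp add: g_def mult.assoc)
  next
    fix \<xi> :: 'a assume "norm \<xi> \<ge> r"
    then show "\<delta> \<le> 1 - norm (?F \<xi>)" using \<delta>(2)[of \<xi>] by linarith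
  qed
qed

definition symbol_integral :: "('a::euclidean_space \<Rightarrow> real) \<Rightarrow> ('a \<Rightarrow> complex) \<Rightarrow> real \<Rightarrow> real" where
  "symbol_integral J u t =
     (LINT \<xi>|lborel. exp (- (t * (1 - norm (fourier (\<lambda>x. complex_of_real (J x)) \<xi>)))) * norm (fourier u \<xi>))"

context
  fixes J :: "'a::euclidean_space \<Rightarrow> real" and u :: "'a \<Rightarrow> complex"
  assumes J: "integrable lborel J" and J1: "(LINT x|lborel. norm (J x)) = 1"
    and u: "integrable lborel u" and fu: "integrable lborel (fourier u)"
begin

lemma integrable_symbol_integrand:
  assumes t: "t \<ge> 0"
  shows "integrable lborel (\<lambda>\<xi>. exp (- (t * (1 - norm (fourier (\<lambda>x. complex_of_real (J x)) \<xi>)))) * norm (fourier u \<xi>))"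
proof -
  have [measurable]: "fourier (\<lambda>x. complex_of_real (J x)) \<in> borel_measurable borel" "fourier u \<in> borel_measurable borel"
    using J u by (auto intro!: borel_measurable_fourier)
  show ?thesis
  proof (rule Bochner_Integration.integrable_bound[OF fu])
    show "AE \<xi> in lborel. norm (exp (- (t * (1 - norm (fourier (\<lambda>x. complex_of_real (J x)) \<xi>)))) * norm (fourier u \<xi>)) \<le> norm (fourier u \<xi>)"
      using norm_fourier_le_1[OF J J1] t by (auto intro!: AE_I2 mult_left_le_one_le simp: abs_mult)
  qed measurable
qed

lemma symbol_integral_le_L1:
  assumes "t \<ge> 0"
  shows "symbol_integral J u t \<le> (LINT \<xi>|lborel. norm (fourier u \<xi>))"
  unfolding symbol_integral_def
  using integrable_symbol_integrand[OF assms] fu norm_fourier_le_1[OF J J1] assms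
  by (intro integral_mono) (auto intro!: mult_left_le_one_le)

text \<open>
  The inequality \<open>x \<le> exp (- (1 - x))\<close>, applied to the modulus of the transform of \<open>J\<close>, replaces
  the discrete power \<open>k\<close> by a real parameter.
\<close>

lemma AE_norm_conv_op_funpow_le_symbol:
  "AE x in lborel. norm ((conv_op J ^^ k) u x) \<le> symbol_integral J u (real k) / (2 * pi) ^ DIM('a)"
proof -
  let ?F = "fourier (\<lambda>x. complex_of_real (J x))"
  have "(LINT \<xi>|lborel. norm (?F \<xi>) ^ k * norm (fourier u \<xi>)) \<le> symbol_integral J u (real k)"
    unfolding symbol_integral_def
  proof (intro integral_mono integrable_norm_fourier_pow[OF J J1 u fu] integrable_symbol_integrand mult_right_mono)
    fix \<xi> :: 'a
    have "norm (?F \<xi>) \<le> exp (- (1 - norm (?F \<xi>)))" using exp_ge_add_one_self[of "- (1 - norm (?F \<xi>))"] by simp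
    then have "norm (?F \<xi>) ^ k \<le> exp (- (1 - norm (?F \<xi>))) ^ k" by (rule power_mono) simp
    also have "\<dots> = exp (- (real k * (1 - norm (?F \<xi>))))" by (simp add: exp_of_nat_mult[symmetric] algebra_simps)
    finally show "norm (?F \<xi>) ^ k \<le> exp (- (real k * (1 - norm (?F \<xi>))))" .
  qed auto
  then have "(LINT \<xi>|lborel. norm (?F \<xi>) ^ k * norm (fourier u \<xi>)) / (2 * pi) ^ DIM('a)
     \<le> symbol_integral J u (real k) / (2 * pi) ^ DIM('a)" by (intro divide_right_mono) auto
  with AE_norm_conv_op_funpow_le[OF J J1 u fu, of k] show ?thesis
    by (auto elim!: AE_mp)
qed

text \<open>
  Summing the bounds for the iterates inside the integral produces partial sums of the
  exponential series of \<open>t |m|\<close>, where \<open>m\<close> is the transform of \<open>J\<close>, hence the factor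
  \<open>exp (- t) exp (t |m|) = exp (- t (1 - |m|))\<close>.
\<close>

lemma poisson_average_conv_op:
  assumes t: "t \<ge> 0"
  defines "w \<equiv> \<lambda>x. complex_of_real (exp (- t)) * (\<Sum>k. complex_of_real (t ^ k / fact k) * (conv_op J ^^ k) u x)"
  shows "integrable lborel w" and "(LINT x|lborel. norm (w x)) \<le> (LINT x|lborel. norm (u x))"
    and "AE x in lborel. norm (w x) \<le> symbol_integral J u t / (2 * pi) ^ DIM('a)"
proof -
  let ?F = "fourier (\<lambda>x. complex_of_real (J x))"
  define m where "m k = (LINT \<xi>|lborel. norm (?F \<xi>) ^ k * norm (fourier u \<xi>)) / (2 * pi) ^ DIM('a)" for k
  have M: "(\<Sum>k<n. t ^ k / fact k * m k) \<le> exp t * (symbol_integral J u t / (2 * pi) ^ DIM('a))" for n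
  proof -
    note i = integrable_norm_fourier_pow[OF J J1 u fu]
    have "(\<Sum>k<n. t ^ k / fact k * m k) = (LINT \<xi>|lborel. (\<Sum>k<n. t ^ k / fact k * (norm (?F \<xi>) ^ k * norm (fourier u \<xi>)))) / (2 * pi) ^ DIM('a)"
      using i by (simp add: m_def sum_divide_distrib Bochner_Integration.integral_sum)
    also have "\<dots> \<le> (LINT \<xi>|lborel. exp t * (exp (- (t * (1 - norm (?F \<xi>)))) * norm (fourier u \<xi>))) / (2 * pi) ^ DIM('a)"
    proof (intro divide_right_mono integral_mono)
      fix \<xi> :: 'a
      have "(\<Sum>k<n. t ^ k / fact k * (norm (?F \<xi>) ^ k * norm (fourier u \<xi>))) = (\<Sum>k<n. (t * norm (?F \<xi>)) ^ k / fact k) * norm (fourier u \<xi>)"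
        by (simp add: sum_distrib_left sum_distrib_right power_mult_distrib mult_ac)
      also have "\<dots> \<le> exp (t * norm (?F \<xi>)) * norm (fourier u \<xi>)"
      proof (rule mult_right_mono)
        have s: "(\<lambda>k. (t * norm (?F \<xi>)) ^ k / fact k) sums exp (t * norm (?F \<xi>))"
          using exp_converges[of "t * norm (?F \<xi>)"] by (simp add: divide_inverse mult.commute)
        show "(\<Sum>k<n. (t * norm (?F \<xi>)) ^ k / fact k) \<le> exp (t * norm (?F \<xi>))"
          unfolding sums_unique[OF s] using t by (intro sum_le_suminf sums_summable[OF s]) auto
      qed simp
      also have "exp (t * norm (?F \<xi>)) = exp t * exp (- (t * (1 - norm (?F \<xi>))))"
        by (simp add: exp_add[symmetric] algebra_simps)
      finally show "(\<Sum>k<n. t ^ k / fact k * (norm (?F \<xi>) ^ k * norm (fourier u \<xi>))) \<le> exp t * (exp (- (t * (1 - norm (?F \<xi>)))) * norm (fourier u \<xi>))"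
        by (simp add: mult.assoc)
    qed (use i integrable_symbol_integrand[OF t] in auto)
    finally show ?thesis by (simp add: symbol_integral_def)
  qed
  note P = poisson_average[where f = "\<lambda>k. (conv_op J ^^ k) u" and m = m, OF integrable_conv_op_funpow[OF J J1 u]
      integral_norm_conv_op_funpow_le[OF J J1 u] AE_norm_conv_op_funpow_le[OF J J1 u fu, folded m_def] t M]
  show "integrable lborel w" "(LINT x|lborel. norm (w x)) \<le> (LINT x|lborel. norm (u x))"
    "AE x in lborel. norm (w x) \<le> symbol_integral J u t / (2 * pi) ^ DIM('a)"
    unfolding w_def using P by blast+
qed

end

lemma conv_op_funpow_rep:
  fixes J :: "'a::euclidean_space \<Rightarrow> real"
  assumes J': "integrable lborel J'" "(LINT x|lborel. norm (J' x)) = 1" and u': "integrable lborel u'"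
    and JJ': "AE x in lborel. J x = J' x" and uu': "AE x in lborel. u x = u' x"
  shows "AE x in lborel. (conv_op J ^^ k) u x = (conv_op J' ^^ k) u' x"
proof (induction k)
  case (Suc k)
  have "conv_op J ((conv_op J ^^ k) u) = conv_op J' ((conv_op J' ^^ k) u')"
    using borel_measurable_integrable[OF J'(1)] borel_measurable_integrable[OF integrable_conv_op_funpow[OF J' u', of k]]
    by (intro conv_op_rep(1) JJ' Suc.IH) auto
  then show ?case by simp
qed (use uu' in simp)

lemma symbol_integral_decay:
  fixes J :: "'a::euclidean_space \<Rightarrow> real"
  assumes J: "integrable lborel J" and J_nonneg: "AE x in lborel. J x \<ge> 0" and J1: "(LINT x|lborel. J x) = 1"
    and L: "slowly_varying L" and N0: "N\<^sub>0 > 0" and \<sigma>: "\<sigma> > 0" and A: "A > 0" and \<gamma>: "\<gamma> > 0"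
    and cases: "mono_on {N\<^sub>0..} L \<and> \<gamma> > \<sigma> \<or> antimono_on {N\<^sub>0..} L \<and> \<gamma> = \<sigma>"
    and asymp: "(\<lambda>\<xi>. fourier (\<lambda>x. complex_of_real (J x)) \<xi>
            - complex_of_real (1 - A * norm \<xi> powr \<sigma> * L (norm \<xi> powr (- \<gamma>))))
         \<in> o[at 0](\<lambda>\<xi>. complex_of_real (norm \<xi> powr \<sigma> * L (norm \<xi> powr (- \<gamma>))))"
  obtains C t\<^sub>0 where "C > 0" "t\<^sub>0 > 0"
    "\<And>u t. integrable lborel u \<Longrightarrow> integrable lborel (fourier u) \<Longrightarrow> t \<ge> t\<^sub>0 \<Longrightarrow>
       symbol_integral J u t \<le> C * ((LINT x|lborel. norm (u x)) + (LINT \<xi>|lborel. norm (fourier u \<xi>)))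
         * (t * L t) powr (- (real DIM('a) / \<sigma>))"
proof -
  let ?\<phi> = "\<lambda>\<xi>. 1 - norm (fourier (\<lambda>x. complex_of_real (J x)) \<xi>)"
  obtain r \<delta> where r: "r > 0" "r powr (- \<gamma>) \<ge> N\<^sub>0" and \<delta>: "\<delta> > 0"
    and near: "\<And>\<xi>. \<xi> \<noteq> 0 \<Longrightarrow> norm \<xi> \<le> r \<Longrightarrow> A / 2 * norm \<xi> powr \<sigma> * L (norm \<xi> powr (- \<gamma>)) \<le> ?\<phi> \<xi>"
    and far: "\<And>\<xi>. norm \<xi> \<ge> r \<Longrightarrow> \<delta> \<le> ?\<phi> \<xi>"
    using symbol_estimates[OF J J_nonneg J1 L N0 A \<gamma> asymp] by metis
  have [measurable]: "fourier (\<lambda>x. complex_of_real (J x)) \<in> borel_measurable borel"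
    using J by (auto intro!: borel_measurable_fourier)
  have m: "?\<phi> \<in> borel_measurable borel" by measurable
  have A2: "A / 2 > 0" using A by simp
  obtain C t\<^sub>0 where C: "C > 0" "t\<^sub>0 > 0" and
    bound: "\<And>(t::real) (v::'a \<Rightarrow> real) (V::real). t \<ge> t\<^sub>0 \<Longrightarrow> integrable lborel v \<Longrightarrow> (\<And>\<xi>. 0 \<le> v \<xi>) \<Longrightarrow> (\<And>\<xi>. v \<xi> \<le> V) \<Longrightarrow>
       (LINT \<xi>|lborel. exp (- (t * ?\<phi> \<xi>)) * v \<xi>)
       \<le> C * (V + (LINT \<xi>|lborel. v \<xi>)) * (t * L t) powr (- (real DIM('a) / \<sigma>))"
    by (rule integral_exp_neg_regular_variation[OF L N0 \<sigma> \<gamma> A2 r \<delta> cases m near far]) blast+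
  show thesis
  proof (rule that[OF C])
    fix u :: "'a \<Rightarrow> complex" and t :: real
    assume u: "integrable lborel u" and fu: "integrable lborel (fourier u)" and t: "t \<ge> t\<^sub>0"
    show "symbol_integral J u t \<le> C * ((LINT x|lborel. norm (u x)) + (LINT \<xi>|lborel. norm (fourier u \<xi>)))
         * (t * L t) powr (- (real DIM('a) / \<sigma>))"
      unfolding symbol_integral_def
      by (rule bound[OF t]) (use fu norm_fourier_le[OF u] in auto)
  qed
qed

lemma enn2real_inverse_less_1:
  assumes "1 < (p::ennreal)"
  shows "enn2real (1 / p) < 1"
proof (cases "p = \<infinity>")
  case False
  define q where "q = enn2real p"
  have pq: "p = ennreal q" using False by (simp add: q_def less_top)
  then have q: "q > 1" using assms unfolding pq ennreal_1[symmetric] by (simp add: ennreal_less_iff)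
  then have "1 / p = ennreal (1 / q)" using divide_ennreal[of 1 q] by (simp add: pq)
  then show ?thesis using q by simp
qed simp

theorem theorem8:
  fixes J :: "real ^ 'n \<Rightarrow> real"
  assumes "radial J" and "\<And>x. J x \<ge> 0"
    and "J \<in> Lp_space 1" and "Lp_norm 1 J = 1"
  shows "\<exists>N::nat. N > 0 \<and>
    (\<forall>(L :: real \<Rightarrow> real) (N\<^sub>0 :: real) (\<beta> :: real) (p :: ennreal) (\<sigma> :: real) (A :: real) (\<gamma> :: real).
       slowly_varying L \<longrightarrow> N\<^sub>0 > 0 \<longrightarrow> \<beta> > 0 \<longrightarrow>
       1 < p \<longrightarrow> p \<le> ennreal (real CARD('n)) / ennreal (max (real CARD('n) - 2 * \<beta>) 0) \<longrightarrow>
       \<sigma> = real CARD('n) / \<beta> * (1 - enn2real (1 / p)) \<longrightarrow>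
       A > 0 \<longrightarrow> \<gamma> > 0 \<longrightarrow>
       (mono_on {N\<^sub>0..} L \<and> \<gamma> > \<sigma> \<or> antimono_on {N\<^sub>0..} L \<and> \<gamma> = \<sigma>) \<longrightarrow>
       (\<lambda>\<xi>. fourier (\<lambda>x. complex_of_real (J x)) \<xi>
            - complex_of_real (1 - A * norm \<xi> powr \<sigma> * L (norm \<xi> powr (- \<gamma>))))
         \<in> o[at 0](\<lambda>\<xi>. complex_of_real (norm \<xi> powr \<sigma> * L (norm \<xi> powr (- \<gamma>)))) \<longrightarrow>
       (\<exists>C>0. \<forall>u0 :: real ^ 'n \<Rightarrow> complex.
          u0 \<in> Lp_space 1 \<longrightarrow> fourier u0 \<in> Lp_space 1 \<longrightarrow>
          (\<forall>k. (conv_op J ^^ k) u0 \<in> Lp_space p) \<and>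
          (\<forall>k\<ge>N. Lp_norm p ((conv_op J ^^ k) u0)
             \<le> C * (Lp_norm 1 u0 + Lp_norm 1 (fourier u0)) * (real k * L (real k)) powr (- \<beta>)) \<and>
          (\<exists>K>0. \<exists>t\<^sub>0>0. \<forall>t\<ge>t\<^sub>0.
             nonlocal_solution J u0 t \<in> Lp_space p \<and>
             Lp_norm p (nonlocal_solution J u0 t) \<le> K * (t * L t) powr (- \<beta>))))"
proof -
  obtain J' where J': "integrable lborel J'" and JJ': "AE x in lborel. J x = J' x"
    using ex_borel_rep_real assms(3) by (auto simp: Lp_space_1_iff)
  have J'_nonneg: "AE x in lborel. J' x \<ge> 0"
    using JJ' by eventually_elim (use assms(2) in metis)
  have "(LINT x|lborel. norm (J' x)) = (LINT x|lebesgue. norm (J x))"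
    by (rule integral_lebesgue_rep[symmetric]) (use J' JJ' in \<open>auto elim!: eventually_mono\<close>)
  then have J'1: "(LINT x|lborel. norm (J' x)) = 1" using assms(4) by (simp add: Lp_norm_1)
  moreover have "(LINT x|lborel. norm (J' x)) = (LINT x|lborel. J' x)"
    by (rule integral_cong_AE) (use J' J'_nonneg in \<open>auto elim!: eventually_mono\<close>)
  ultimately have J'int: "(LINT x|lborel. J' x) = 1" by simp
  have FJ: "fourier (\<lambda>x. complex_of_real (J x)) = fourier (\<lambda>x. complex_of_real (J' x))"
    by (intro ext fourier_rep) (use J' JJ' in \<open>auto elim!: eventually_mono\<close>)
  define P where "P = (2 * pi) ^ CARD('n)"
  have P: "P > 0" by (simp add: P_def)
  show ?thesis
  proof (intro exI[of _ "1::nat"] conjI allI impI)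
    fix L :: "real \<Rightarrow> real" and N\<^sub>0 \<beta> :: real and p :: ennreal and \<sigma> A \<gamma> :: real
    assume L: "slowly_varying L" and N0: "N\<^sub>0 > 0" and \<beta>: "\<beta> > 0" and p: "1 < p"
      and \<sigma>_def: "\<sigma> = real CARD('n) / \<beta> * (1 - enn2real (1 / p))"
      and A: "A > 0" and \<gamma>: "\<gamma> > 0"
      and cases: "mono_on {N\<^sub>0..} L \<and> \<gamma> > \<sigma> \<or> antimono_on {N\<^sub>0..} L \<and> \<gamma> = \<sigma>"
      and asymp: "(\<lambda>\<xi>. fourier (\<lambda>x. complex_of_real (J x)) \<xi>
            - complex_of_real (1 - A * norm \<xi> powr \<sigma> * L (norm \<xi> powr (- \<gamma>))))
         \<in> o[at 0](\<lambda>\<xi>. complex_of_real (norm \<xi> powr \<sigma> * L (norm \<xi> powr (- \<gamma>))))"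
    define c where "c = 1 - enn2real (1 / p)"
    have c: "c > 0" using enn2real_inverse_less_1[OF p] by (simp add: c_def)
    have \<sigma>: "\<sigma> > 0" using c \<beta> by (simp add: \<sigma>_def c_def)
    define D where "D = real CARD('n) / \<sigma>"
    have Dc: "D * c = \<beta>" using c \<beta> by (simp add: D_def \<sigma>_def flip: c_def)
    define X where "X t = t * L t" for t
    have X: "X t > 0" if "t > 0" for t using slowly_varying_pos[OF L that] that by (simp add: X_def)
    obtain C t\<^sub>0 where C: "C > 0" and t0: "t\<^sub>0 > 0" and
      decay: "\<And>u t. integrable lborel u \<Longrightarrow> integrable lborel (fourier u) \<Longrightarrow> t \<ge> t\<^sub>0 \<Longrightarrow>
       symbol_integral J' u t \<le> C * ((LINT x|lborel. norm (u x)) + (LINT \<xi>|lborel. norm (fourier u \<xi>))) * X t powr (- D)"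
      using symbol_integral_decay[OF J' J'_nonneg J'int L N0 \<sigma> A \<gamma> cases asymp[unfolded FJ]]
      unfolding X_def D_def by auto
    \<comment> \<open>\<open>C\<^sub>1\<close> serves all \<open>k \<ge> t\<^sub>0\<close>; \<open>C\<^sub>2\<close> compensates the rate for the finitely many smaller \<open>k\<close>, where
      only the trivial bound on the iterates is available.\<close>
    define m where "m = nat \<lceil>t\<^sub>0\<rceil>"
    define C\<^sub>1 where "C\<^sub>1 = (C / P) powr c"
    define C\<^sub>2 where "C\<^sub>2 = (\<Sum>k\<in>{1..<m}. (1 / P) powr c * X (real k) powr \<beta>)"
    have C1: "C\<^sub>1 > 0" using C P by (simp add: C\<^sub>1_def)
    have C2: "C\<^sub>2 \<ge> 0" unfolding C\<^sub>2_def by (intro sum_nonneg mult_nonneg_nonneg) auto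
    show "\<exists>C>0. \<forall>u0 :: real ^ 'n \<Rightarrow> complex.
          u0 \<in> Lp_space 1 \<longrightarrow> fourier u0 \<in> Lp_space 1 \<longrightarrow>
          (\<forall>k. (conv_op J ^^ k) u0 \<in> Lp_space p) \<and>
          (\<forall>k\<ge>1. Lp_norm p ((conv_op J ^^ k) u0)
             \<le> C * (Lp_norm 1 u0 + Lp_norm 1 (fourier u0)) * (real k * L (real k)) powr (- \<beta>)) \<and>
          (\<exists>K>0. \<exists>t\<^sub>0>0. \<forall>t\<ge>t\<^sub>0.
             nonlocal_solution J u0 t \<in> Lp_space p \<and>
             Lp_norm p (nonlocal_solution J u0 t) \<le> K * (t * L t) powr (- \<beta>))"
    proof (rule exI[of _ "C\<^sub>1 + C\<^sub>2"], intro conjI allI impI)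
      show "C\<^sub>1 + C\<^sub>2 > 0" using C1 C2 by simp
      fix u0 :: "real ^ 'n \<Rightarrow> complex"
      assume u0: "u0 \<in> Lp_space 1" and fu0: "fourier u0 \<in> Lp_space 1"
      obtain u where u: "integrable lborel u" and u0u: "AE x in lborel. u0 x = u x"
        using ex_borel_rep_complex u0 by (auto simp: Lp_space_1_iff)
      have Fu: "fourier u0 = fourier u"
        by (intro ext fourier_rep) (use u u0u in auto)
      have fu: "integrable lborel (fourier u)"
        using fu0 borel_measurable_fourier[OF u] by (simp add: Lp_space_1_iff Fu integrable_completion)
      define S where "S = (LINT x|lborel. norm (u x)) + (LINT \<xi>|lborel. norm (fourier u \<xi>))"
      have Lu: "Lp_norm 1 u0 = (LINT x|lborel. norm (u x))"
        unfolding Lp_norm_1 by (rule integral_lebesgue_rep) (use u u0u in \<open>auto elim!: eventually_mono\<close>)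
      have Lfu: "Lp_norm 1 (fourier u0) = (LINT \<xi>|lborel. norm (fourier u \<xi>))"
        unfolding Lp_norm_1 Fu by (rule integral_lebesgue_rep) (use borel_measurable_fourier[OF u] in auto)
      have S_eq: "Lp_norm 1 u0 + Lp_norm 1 (fourier u0) = S" by (simp add: S_def Lu Lfu)
      have S: "S \<ge> 0" by (simp add: S_def)
      have interp: "w \<in> Lp_space p \<and> Lp_norm p w \<le> (B / P) powr c * S"
        if w': "integrable lborel w'" and ww': "AE x in lborel. w x = w' x"
          and L1: "(LINT x|lborel. norm (w' x)) \<le> (LINT x|lborel. norm (u x))"
          and sup: "AE x in lborel. norm (w' x) \<le> I / P" and I: "I \<le> B * S" and B: "B > 0"
        for w w' :: "real ^ 'n \<Rightarrow> complex" and I B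
      proof -
        have w: "integrable lebesgue w" using integrable_lebesgue_rep[OF _ ww'] w' by simp
        have "(LINT x|lebesgue. norm (w x)) = (LINT x|lborel. norm (w' x))"
          by (rule integral_lebesgue_rep) (use w' ww' in \<open>auto elim!: eventually_mono\<close>)
        also have "\<dots> \<le> S" using L1 by (simp add: S_def add_increasing2)
        finally have 1: "(LINT x|lebesgue. norm (w x)) \<le> S" .
        have "AE x in lborel. norm (w x) \<le> (B / P) * S"
          using sup ww'
        proof eventually_elim
          case (elim x)
          have "I / P \<le> B * S / P" using I P by (intro divide_right_mono) auto
          then show ?case using elim by simp
        qed
        then have 2: "AE x in lebesgue. norm (w x) \<le> (B / P) * S" by (rule AE_completion)
        have "B / P > 0" using B P by simp
        from Lp_interpolation_1_infinity[OF w p this 2 1] show ?thesis by (simp add: c_def)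
      qed
      note AEk = conv_op_funpow_rep[OF J' J'1 u JJ' u0u]
      note intk = integrable_conv_op_funpow[OF J' J'1 u] integral_norm_conv_op_funpow_le[OF J' J'1 u]
      have supk: "AE x in lborel. norm ((conv_op J' ^^ k) u x) \<le> symbol_integral J' u (real k) / P" for k
        using AE_norm_conv_op_funpow_le_symbol[OF J' J'1 u fu, of k] by (simp add: P_def)
      have triv: "(conv_op J ^^ k) u0 \<in> Lp_space p \<and> Lp_norm p ((conv_op J ^^ k) u0) \<le> (1 / P) powr c * S" for k
      proof (rule interp[OF intk(1) AEk intk(2) supk])
        have "symbol_integral J' u (real k) \<le> (LINT \<xi>|lborel. norm (fourier u \<xi>))"
          by (rule symbol_integral_le_L1[OF J' J'1 u fu]) simp
        then show "symbol_integral J' u (real k) \<le> 1 * S" by (simp add: S_def add_increasing)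
      qed simp
      have rate: "(C * X t powr (- D) / P) powr c * S = C\<^sub>1 * S * X t powr (- \<beta>)" if "t > 0" for t
      proof -
        have "(C * X t powr (- D) / P) powr c = (C / P * X t powr (- D)) powr c" by simp
        also have "\<dots> = C\<^sub>1 * (X t powr (- D)) powr c"
          using C P by (subst powr_mult) (auto simp: C\<^sub>1_def)
        also have "(X t powr (- D)) powr c = X t powr (- \<beta>)" by (simp add: powr_powr Dc)
        finally show ?thesis by simp
      qed
      show "(conv_op J ^^ k) u0 \<in> Lp_space p" for k using triv by blast
      show "Lp_norm p ((conv_op J ^^ k) u0)
          \<le> (C\<^sub>1 + C\<^sub>2) * (Lp_norm 1 u0 + Lp_norm 1 (fourier u0)) * (real k * L (real k)) powr (- \<beta>)"
        if k: "k \<ge> 1" for k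
      proof -
        have Xk: "X (real k) > 0" using k by (intro X) simp
        have "Lp_norm p ((conv_op J ^^ k) u0) \<le> (C\<^sub>1 + C\<^sub>2) * S * X (real k) powr (- \<beta>)"
        proof (cases "k < m")
          case True
          have "(1 / P) powr c * X (real k) powr \<beta> \<le> C\<^sub>2"
            unfolding C\<^sub>2_def by (rule member_le_sum) (use True k in auto)
          then have "((1 / P) powr c * X (real k) powr \<beta>) * (S * X (real k) powr (- \<beta>)) \<le> (C\<^sub>1 + C\<^sub>2) * (S * X (real k) powr (- \<beta>))"
            using C1 S by (intro mult_right_mono) auto
          moreover have "((1 / P) powr c * X (real k) powr \<beta>) * (S * X (real k) powr (- \<beta>)) = (1 / P) powr c * S"
            using Xk by (simp add: powr_minus field_simps)
          ultimately have "(1 / P) powr c * S \<le> (C\<^sub>1 + C\<^sub>2) * (S * X (real k) powr (- \<beta>))"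
            by (simp only:)
          then have "Lp_norm p ((conv_op J ^^ k) u0) \<le> (C\<^sub>1 + C\<^sub>2) * (S * X (real k) powr (- \<beta>))"
            using triv[of k] by linarith
          then show ?thesis by (simp add: mult.assoc)
        next
          case False
          then have kt: "real k \<ge> t\<^sub>0" unfolding m_def by linarith
          have "Lp_norm p ((conv_op J ^^ k) u0) \<le> (C * X (real k) powr (- D) / P) powr c * S"
            using interp[OF intk(1) AEk intk(2) supk, of k "C * X (real k) powr (- D)"] decay[OF u fu kt] C Xk
            by (simp add: S_def mult_ac)
          also have "\<dots> = C\<^sub>1 * (S * X (real k) powr (- \<beta>))" using rate[of "real k"] k by simp
          also have "\<dots> \<le> (C\<^sub>1 + C\<^sub>2) * (S * X (real k) powr (- \<beta>))" using C2 S by (intro mult_right_mono) auto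
          finally show ?thesis by (simp add: mult.assoc)
        qed
        then show ?thesis by (simp add: S_eq X_def)
      qed
      show "\<exists>K>0. \<exists>t\<^sub>0>0. \<forall>t\<ge>t\<^sub>0. nonlocal_solution J u0 t \<in> Lp_space p \<and>
             Lp_norm p (nonlocal_solution J u0 t) \<le> K * (t * L t) powr (- \<beta>)"
        \<comment> \<open>The summand 1 keeps the constant positive when \<open>u0\<close> vanishes almost everywhere.\<close>
      proof (rule exI[of _ "C\<^sub>1 * S + 1"], intro conjI)
        show "C\<^sub>1 * S + 1 > 0" using C1 S by (simp add: add_nonneg_pos)
        show "\<exists>t\<^sub>0>0. \<forall>t\<ge>t\<^sub>0. nonlocal_solution J u0 t \<in> Lp_space p \<and>
             Lp_norm p (nonlocal_solution J u0 t) \<le> (C\<^sub>1 * S + 1) * (t * L t) powr (- \<beta>)"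
        proof (rule exI[of _ t\<^sub>0], intro conjI allI impI)
          show "t\<^sub>0 > 0" by (rule t0)
          fix t assume t: "t \<ge> t\<^sub>0"
          then have tpos: "t > 0" using t0 by linarith
          define w where "w x = complex_of_real (exp (- t)) * (\<Sum>k. complex_of_real (t ^ k / fact k) * (conv_op J' ^^ k) u x)" for x
          note w = poisson_average_conv_op[OF J' J'1 u fu, of t, folded w_def]
          have "AE x in lborel. \<forall>k. (conv_op J ^^ k) u0 x = (conv_op J' ^^ k) u x"
            using AEk by (simp add: AE_all_countable)
          then have ae: "AE x in lborel. nonlocal_solution J u0 t x = w x"
            by eventually_elim (simp add: nonlocal_solution_def w_def assms(4))
          have "nonlocal_solution J u0 t \<in> Lp_space p \<and>
              Lp_norm p (nonlocal_solution J u0 t) \<le> (C * X t powr (- D) / P) powr c * S"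
            by (rule interp[OF w(1) ae w(2)])
              (use w(3) tpos decay[OF u fu t] C X[OF tpos] in \<open>auto simp: P_def S_def mult_ac\<close>)
          then have *: "nonlocal_solution J u0 t \<in> Lp_space p"
              "Lp_norm p (nonlocal_solution J u0 t) \<le> C\<^sub>1 * S * X t powr (- \<beta>)"
            using rate[OF tpos] by auto
          show "nonlocal_solution J u0 t \<in> Lp_space p" by (rule *)
          have "C\<^sub>1 * S * X t powr (- \<beta>) \<le> (C\<^sub>1 * S + 1) * X t powr (- \<beta>)" by (intro mult_right_mono) auto
          then show "Lp_norm p (nonlocal_solution J u0 t) \<le> (C\<^sub>1 * S + 1) * (t * L t) powr (- \<beta>)"
            using *(2) by (simp add: X_def)
        qed
      qed
    qed
  qed simp
qed

end
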